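(* Let $f_1,\dots,f_n$ be the local objective functions of $n$ nodes and $f(\mathbf{x})=\sum_{i=1}^n f_i(\mathbf{x})$, $\mathbf{x}\in\mathbb{R}^p$. Suppose that: (a) $f$ is twice continuously differentiable and $\mu$-strongly convex, i.e. there is $\mu>0$ with $\nabla^2 f(\mathbf{x})\succeq\mu I$ for all $\mathbf{x}$; (b) $f$ has $L$-Lipschitz continuous Hessian, i.e. $\|\nabla^2 f(\mathbf{x})-\nabla^2 f(\mathbf{y})\|\le L\|\mathbf{x}-\mathbf{y}\|$ for all $\mathbf{x},\mathbf{y}$; (c) the Hessian of $f$ is upper bounded by $M$, i.e. $\nabla^2 f(\mathbf{x})\preceq MI$ for all $\mathbf{x}\in\mathbb{R}^p$; (d) the communication network over the nodes $\mathcal{V}=\{1,\dots,n\}$ is strongly connected; (e) each node has a unique identifier. Let $\{\mathbf{x}_k^{(i)}\}$ be generated by the DAN-LA algorithm (the communication-efficient Distributed Adaptive Newton method with low-rank approximation). Then for any value $c>0$ of its parameter $c$ and any $i\in\mathcal{V}$, $\|\mathbf{x}_k^{(i)}-\mathbf{x}^\star\|$ converges superlinearly to $0$, where $\mathbf{x}^\star$ is the optimal point of the problem of minimizing $\sum_{i=1}^n f_i(\mathbf{x}_i)$ subject to $\mathbf{x}_1=\cdots=\mathbf{x}_n\in\mathbb{R}^p$, i.e. the minimizer of $f$.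
   Context: $\|\cdot\|$ is the $\ell_2$-norm for vectors and the spectral norm for matrices; $A\succeq B$ (equivalently $B\preceq A$) means $A-B$ is non-negative definite. The communication network is a directed graph $\mathcal{G}=(\mathcal{V},\mathcal{E})$, with $(i,j)\in\mathcal{E}$ if and only if node $i$ can directly send messages to node $j$; it is undirected if $(i,j)\in\mathcal{E}$ implies $(j,i)\in\mathcal{E}$. It is strongly connected if there is a directed path between any pair of nodes. Convergence rate: $\{e_k\}$ converges to $0$ with a $Q$-superlinear rate if $\lim_{k\to\infty}|e_{k+1}|/|e_k|=0$. A sequence $\{\varepsilon_k\}$ converges superlinearly (in the $R$-sense, the sense always used here) if there is a $Q$-superlinearly convergent sequence $\{e_k\}$ with $|\varepsilon_k|\le|e_k|$ for all $k$. Distributed Selective Flooding (DSF): node $i$ has a message $\mathcal{S}_i$ and sets $\mathcal{I}_i(0)=\{\mathcal{S}_i\}$. In each communication round $t=1,\dots,n-1$: if $\mathcal{G}$ is undirected, then for each neighbor $j$, node $i$ selects an element $e\in\mathcal{I}_i(t-1)$ that it has neither sent to node $j$ nor received from node $j$ before, and sends $e$ to $j$; if $\mathcal{G}$ is directed, then for each out-neighbor $j$, node $i$ selects an element $e\in\mathcal{I}_i(t-1)$ that it has not sent to $j$, and sends $e$ to $j$. Node $i$ receives an element $e_j$ from each neighbor $j$ that sends to it and sets $\mathcal{I}_i(t)$ to be $\mathcal{I}_i(t-1)$ together with these elements. The output is $\mathcal{I}_i(n-1)=\{\mathcal{S}_u: u\in\mathcal{V}\}$ for all $i$, the messages of all nodes.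 (On an undirected network that is not a tree, a spanning tree is first constructed in a distributed manner and DSF is applied on it.) DAN-LA: node $i$ privately holds $f_i$. Initialization: common starting point $\mathbf{x}_0^{(i)}=\mathbf{x}_0$, $\mathbf{g}_0^{(i)}=\nabla f_i(\mathbf{x}_0)$, $\hat H_{-1}^{(i)}=H_{-1}^{(i)}=0$, a parameter $c>0$, and the constants $\mu,L,M$ above. Set $M_c=M+c$ and $$\underline r=\frac13\sqrt{M_c^2+3\mu^2}-\frac{M_c}{3},\qquad \phi=\frac{2\mu(\mu-\underline r)^2}{L(M+\mu)}-\frac{2\underline r(\mu-\underline r)}{L}>0.$$ At each iteration $k=0,1,2,\dots$, every node $i$: 1. lets $\lambda_j$ be the $j$-th largest eigenvalue in magnitude of $\nabla^2 f_i(\mathbf{x}_k^{(i)})-H_{k-1}^{(i)}$ (with $\lambda_j=0$ for $j>p$) and $\mathbf{w}_j$ the associated unit eigenvector, and sets $\mathbf{h}_k^{(i)}=\sqrt{|\lambda_1|}\,\mathbf{w}_1$, $s_k^{(i)}=\mathrm{sign}(\lambda_1)$, $r_k^{(i)}=|\lambda_2|$; 2. computes $H_k^{(i)}=H_{k-1}^{(i)}+s_k^{(i)}\mathbf{h}_k^{(i)}(\mathbf{h}_k^{(i)})^{\mathsf T}$ and $\mathbf{g}_k^{(i)}=\nabla f_i(\mathbf{x}_k^{(i)})$; 3. runs DSF with message $(r_k^{(i)},s_k^{(i)},\mathbf{g}_k^{(i)},\mathbf{h}_k^{(i)})$ to obtain $\{(r_k^{(u)},s_k^{(u)},\mathbf{g}_k^{(u)},\mathbf{h}_k^{(u)}):u\in\mathcal{V}\}$;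 4. computes $\hat{\mathbf{g}}_k^{(i)}=\sum_{u=1}^n\mathbf{g}_k^{(u)}$, $\hat H_k^{(i)}=\hat H_{k-1}^{(i)}+\sum_{u=1}^n s_k^{(u)}\mathbf{h}_k^{(u)}(\mathbf{h}_k^{(u)})^{\mathsf T}$ and $\hat r_k^{(i)}=\sum_{u=1}^n r_k^{(u)}$; 5. sets $\alpha_k^{(i)}=\min\big\{1,\phi/\|\hat{\mathbf{g}}_k^{(i)}\|\big\}$ if $\hat r_k^{(i)}\le\underline r$, and $\alpha_k^{(i)}=0$ otherwise; 6. if $\alpha_k^{(i)}=0$, sets $\mathbf{x}_{k+1}^{(i)}=\mathbf{x}_k^{(i)}$; otherwise updates $\mathbf{x}_{k+1}^{(i)}=\mathbf{x}_k^{(i)}-\alpha_k^{(i)}(\hat H_k^{(i)})^{-1}\hat{\mathbf{g}}_k^{(i)}$.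
   Formalization: Each local objective f_i (not only f) is assumed twice continuously differentiable, without which the claim fails; L > 0 is assumed; on directed networks DSF may use more than n−1 rounds and ends with all messages delivered, since n−1 rounds can be insufficient. *)

theory Defs
  imports "HOL-Analysis.Analysis" "Graph_Theory.Digraph_Component"
begin

section \<open>Gradients, Hessians and the matrix order\<close>

definition gradient :: "('a::real_inner \<Rightarrow> real) \<Rightarrow> 'a \<Rightarrow> 'a" where
  "gradient f x = (THE D. GDERIV f x :> D)"

definition hessian :: "(real^'p \<Rightarrow> real) \<Rightarrow> real^'p \<Rightarrow> real^'p^'p" where
  "hessian f x = jacobian (gradient f) (at x)"

definition twice_continuously_differentiable :: "(real^'p \<Rightarrow> real) \<Rightarrow> bool" where
  "twice_continuously_differentiable f \<longleftrightarrow>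
     (\<forall>x. f differentiable (at x)) \<and>
     (\<forall>x. gradient f differentiable (at x)) \<and>
     continuous_on UNIV (hessian f)"

text \<open>\<open>loewner_le A B\<close>: the matrix \<open>B - A\<close> is non-negative definite.\<close>

definition loewner_le :: "real^'p^'p \<Rightarrow> real^'p^'p \<Rightarrow> bool" where
  "loewner_le A B \<longleftrightarrow> (\<forall>v. 0 \<le> v \<bullet> ((B - A) *v v))"

text \<open>The library norm on matrices is the Frobenius norm; the spectral norm is the operator norm.\<close>

definition spectral_norm :: "real^'p^'p \<Rightarrow> real" where
  "spectral_norm A = onorm (\<lambda>v. A *v v)"


section \<open>Superlinear convergence to 0\<close>

text \<open>
  The terms of the majorant are required to be nonzero, since otherwise \<open>x / 0 = 0\<close> would make the
  quotient condition void at some indices.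
\<close>

definition q_superlinear :: "(nat \<Rightarrow> real) \<Rightarrow> bool" where
  "q_superlinear e \<longleftrightarrow>
     e \<longlonglongrightarrow> 0 \<and> (\<forall>k. e k \<noteq> 0) \<and> (\<lambda>k. \<bar>e (Suc k)\<bar> / \<bar>e k\<bar>) \<longlonglongrightarrow> 0"

definition converges_superlinearly :: "(nat \<Rightarrow> real) \<Rightarrow> bool" where
  "converges_superlinearly \<epsilon> \<longleftrightarrow> (\<exists>e. q_superlinear e \<and> (\<forall>k. \<bar>\<epsilon> k\<bar> \<le> \<bar>e k\<bar>))"


section \<open>Distributed Selective Flooding\<close>

text \<open>
  An undirected network is a symmetric digraph, so every edge \<open>u - v\<close> gives the two-arc cycle
  \<open>u \<rightarrow> v \<rightarrow> u\<close>; an undirected tree has no other cycles and no loops. (The library's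
  \<^const>\<open>spanning_tree\<close> only excludes directed cycles, and is not suitable here.)
\<close>

definition undirected_spanning_tree :: "'v pair_pre_digraph \<Rightarrow> 'v pair_pre_digraph \<Rightarrow> bool" where
  "undirected_spanning_tree T G \<longleftrightarrow>
     spanning (with_proj T) (with_proj G) \<and>
     symmetric (with_proj T) \<and> strongly_connected (with_proj T) \<and>
     (\<forall>p. pre_digraph.cycle (with_proj T) p \<longrightarrow> length p = 2)"

text \<open>The network \<open>N\<close> on which the flooding over \<open>G\<close> takes place.\<close>

definition dsf_network :: "'v pair_pre_digraph \<Rightarrow> 'v pair_pre_digraph \<Rightarrow> bool" where
  "dsf_network G N \<longleftrightarrow>
     (if symmetric (with_proj G) then undirected_spanning_tree N G else N = G)"

text \<open>
  \<open>I t i\<close> is the set held by node \<open>i\<close> after round \<open>t\<close>, and \<open>sent t i j\<close> is the element sent by \<open>i\<close>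
  to \<open>j\<close> in round \<open>t\<close>. The choice among the eligible elements is free; a node without eligible
  elements sends nothing.
\<close>

definition dsf_eligible ::
  "bool \<Rightarrow> (nat \<Rightarrow> 'v \<Rightarrow> 'm set) \<Rightarrow> (nat \<Rightarrow> 'v \<Rightarrow> 'v \<Rightarrow> 'm option) \<Rightarrow> nat \<Rightarrow> 'v \<Rightarrow> 'v \<Rightarrow> 'm set" where
  "dsf_eligible undirected I sent t i j =
     {e \<in> I (t - 1) i. \<forall>t'\<in>{1..<t}.
        sent t' i j \<noteq> Some e \<and> (undirected \<longrightarrow> sent t' j i \<noteq> Some e)}"

definition dsf_rounds ::
  "nat \<Rightarrow> bool \<Rightarrow> 'v pair_pre_digraph \<Rightarrow> ('v \<Rightarrow> 'm) \<Rightarrow> (nat \<Rightarrow> 'v \<Rightarrow> 'm set) \<Rightarrow>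
   (nat \<Rightarrow> 'v \<Rightarrow> 'v \<Rightarrow> 'm option) \<Rightarrow> bool" where
  "dsf_rounds T undirected N S I sent \<longleftrightarrow>
     (\<forall>i\<in>pverts N. I 0 i = {S i}) \<and>
     (\<forall>t\<in>{1..T}.
        (\<forall>(i, j)\<in>parcs N.
           if dsf_eligible undirected I sent t i j = {} then sent t i j = None
           else \<exists>e\<in>dsf_eligible undirected I sent t i j. sent t i j = Some e) \<and>
        (\<forall>i\<in>pverts N.
           I t i = I (t - 1) i \<union> {e. \<exists>j. (j, i) \<in> parcs N \<and> sent t j i = Some e}))"

text \<open>
  \<open>out i\<close> is the set obtained by node \<open>i\<close>. On an undirected network these are the sets after
  \<open>n - 1\<close> rounds, with no further condition. On a directed network \<open>n - 1\<close> rounds need not spread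
  all the messages, and for some strongly connected digraphs no selection does so: with the arcs
  \<open>1 \<rightarrow> 2\<close>, \<open>2 \<rightarrow> 3\<close>, \<open>2 \<rightarrow> 4\<close>, \<open>3 \<rightarrow> 1\<close>, \<open>4 \<rightarrow> 1\<close>, node 2 holds at most one of \<open>S 3\<close>, \<open>S 4\<close> after
  two rounds, but would have to send \<open>S 4\<close> to 3 and \<open>S 3\<close> to 4 in the third. There the number of
  rounds may therefore exceed \<open>n - 1\<close>, and the flooding ends with its specified output, the
  messages of all nodes.
\<close>

definition dsf ::
  "'v pair_pre_digraph \<Rightarrow> 'v pair_pre_digraph \<Rightarrow> ('v \<Rightarrow> 'm) \<Rightarrow> ('v \<Rightarrow> 'm set) \<Rightarrow> bool" where
  "dsf G N S out \<longleftrightarrow>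
     (\<exists>T I sent. dsf_rounds T (symmetric (with_proj G)) N S I sent \<and>
        (\<forall>i\<in>pverts N. out i = I T i) \<and>
        (if symmetric (with_proj G) then T = card (pverts N) - 1
         else T \<ge> card (pverts N) - 1 \<and> (\<forall>i\<in>pverts N. out i = S ` pverts N)))"


section \<open>DAN-LA\<close>

text \<open>
  The eigenvalues of a symmetric matrix, with multiplicity, indexed from 1 in decreasing order of
  magnitude, and associated orthonormal eigenvectors; ties may be broken in any way.
\<close>

definition eigen_by_magnitude ::
  "real^'p^'p \<Rightarrow> (nat \<Rightarrow> real) \<Rightarrow> (nat \<Rightarrow> real^'p) \<Rightarrow> bool" where
  "eigen_by_magnitude A lam w \<longleftrightarrow>
     (\<forall>j\<in>{1..CARD('p)}. A *v w j = lam j *\<^sub>R w j) \<and>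
     (\<forall>j\<in>{1..CARD('p)}. \<forall>l\<in>{1..CARD('p)}. w j \<bullet> w l = (if j = l then 1 else 0)) \<and>
     (\<forall>j\<in>{1..<CARD('p)}. \<bar>lam (Suc j)\<bar> \<le> \<bar>lam j\<bar>) \<and>
     (\<forall>j>CARD('p). lam j = 0)"

definition outer_square :: "real^'p \<Rightarrow> real^'p^'p" where
  "outer_square h = (\<chi> a b. h $ a * h $ b)"

definition r_under :: "real \<Rightarrow> real \<Rightarrow> real \<Rightarrow> real" where
  "r_under \<mu> M c = sqrt ((M + c)\<^sup>2 + 3 * \<mu>\<^sup>2) / 3 - (M + c) / 3"

definition step_const :: "real \<Rightarrow> real \<Rightarrow> real \<Rightarrow> real \<Rightarrow> real" where
  "step_const \<mu> L M c =
     2 * \<mu> * (\<mu> - r_under \<mu> M c)\<^sup>2 / (L * (M + \<mu>))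
     - 2 * r_under \<mu> M c * (\<mu> - r_under \<mu> M c) / L"

text \<open>
  \<open>x k i\<close> is the iterate of node \<open>i\<close>. The matrices are shifted by one, \<open>H k i\<close> and \<open>Hhat k i\<close> being
  those with index \<open>k - 1\<close>. Messages carry the identifier of their sender, so that the set \<open>out k i\<close>
  keeps equal data of different nodes apart and the sums over it are sums over the senders.
  For a zero aggregated gradient \<open>\<phi> / 0 = 0\<close> gives step size 0 instead of 1, with the same update.
\<close>

definition danla_run ::
  "'v pair_pre_digraph \<Rightarrow> ('v \<Rightarrow> 'id) \<Rightarrow> ('v \<Rightarrow> real^'p \<Rightarrow> real) \<Rightarrow>
   real \<Rightarrow> real \<Rightarrow> real \<Rightarrow> real \<Rightarrow> (nat \<Rightarrow> 'v \<Rightarrow> real^'p) \<Rightarrow> bool" where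
  "danla_run G ident f \<mu> L M c x \<longleftrightarrow>
     (\<exists>N x0 H Hhat h s r g out.
        dsf_network G N \<and>
        (\<forall>i\<in>pverts G. x 0 i = x0 \<and> H 0 i = 0 \<and> Hhat 0 i = 0) \<and>
        (\<forall>k.
          (\<forall>i\<in>pverts G.
             (\<exists>lam w. eigen_by_magnitude (hessian (f i) (x k i) - H k i) lam w \<and>
                h k i = sqrt \<bar>lam 1\<bar> *\<^sub>R w 1 \<and> s k i = sgn (lam 1) \<and> r k i = \<bar>lam 2\<bar>) \<and>
             H (Suc k) i = H k i + s k i *\<^sub>R outer_square (h k i) \<and>
             g k i = gradient (f i) (x k i)) \<and>
          dsf G N (\<lambda>u. (ident u, r k u, s k u, g k u, h k u)) (out k) \<and>
          (\<forall>i\<in>pverts G.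
             let ghat = (\<Sum>(d, ru, su, gu, hu)\<in>out k i. gu);
                 rhat = (\<Sum>(d, ru, su, gu, hu)\<in>out k i. ru);
                 \<alpha> = (if rhat \<le> r_under \<mu> M c then min 1 (step_const \<mu> L M c / norm ghat) else 0)
             in Hhat (Suc k) i =
                  Hhat k i + (\<Sum>(d, ru, su, gu, hu)\<in>out k i. su *\<^sub>R outer_square hu) \<and>
                x (Suc k) i =
                  (if \<alpha> = 0 then x k i
                   else x k i - \<alpha> *\<^sub>R (matrix_inv (Hhat (Suc k) i) *v ghat)))))"

end

theory Submission
  imports Defs
begin

text \<open>
  The flooding delivers all messages to all nodes, and the identifiers keep them apart. Hence all
  nodes compute the same aggregates, and by induction they share a single iterate \<open>y k\<close> and a single
  matrix, the sum of the local approximations. What remains is a centralized Newton iteration with an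
  approximate Hessian, whose error is bounded by the sum \<open>R k\<close> of the magnitudes of the second
  eigenvalues.

  \<^bold>\<open>Flooding on a tree.\<close> The route of a message is a non-backtracking walk, hence a path
  (\<open>nonbacktracking_distinct\<close>), so different neighbours of a node supply it with different messages.
  By a counting argument an arc is busy in an initial segment of the rounds (\<open>eligible_prefix\<close>). With
  \<open>n\<close> messages altogether, no arc has anything left to send after \<open>n - 1\<close> rounds
  (\<open>nothing_left_to_send\<close>), so neighbours, and then all nodes, hold the same messages.

  \<^bold>\<open>Hessian approximation.\<close> Removing the leading eigencomponent of a symmetric matrix shrinks its
  squared Frobenius norm to at most \<open>1 - 1 / p\<close> of its value (\<open>norm_deflated\<close>). If the iterates
  converge, no matter to which point, the local Hessians have increments tending to 0, and the local
  errors satisfy a linear contraction with a vanishing perturbation. So \<open>R k\<close> tends to 0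
  (\<open>rank_one_tracking\<close>).

  \<^bold>\<open>Newton iteration.\<close> A step taken when \<open>R k\<close> is at most the threshold \<open>r\<close> decreases the gradient norm
  by at least \<open>r / (\<mu> - r)\<close> times the minimum of the gradient norm and \<open>\<phi>\<close>; this uses
  \<open>L * \<phi> \<le> (\<mu> - r) * (\<mu> - 3 * r)\<close> (\<open>step_constants\<close>). So the gradient norms decrease to a limit. If it
  were positive, there would be only finitely many moves, the iterates would become constant, \<open>R k\<close>
  would tend to 0, and there would be another move. Hence the gradients tend to 0 and the iterates to
  the minimizer by strong convexity. Therefore \<open>R k\<close> tends to 0, eventually all steps are full steps,
  and the ratio of successive gradient norms is at most a combination of \<open>R k\<close> and the gradient norm,
  which tends to 0 (\<open>adaptive_newton_superlinear\<close>).
\<close>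

section \<open>Non-backtracking walks\<close>

text \<open>
  A walk, given by its list of vertices, that never returns at once over the edge it just used.
  Lists of length at most one count as walks of any digraph.
\<close>

fun nonbacktracking :: "('v \<times> 'v) set \<Rightarrow> 'v list \<Rightarrow> bool" where
  "nonbacktracking E [] \<longleftrightarrow> True"
| "nonbacktracking E [a] \<longleftrightarrow> True"
| "nonbacktracking E [a, b] \<longleftrightarrow> (a, b) \<in> E"
| "nonbacktracking E (a # b # c # xs) \<longleftrightarrow>
     (a, b) \<in> E \<and> a \<noteq> c \<and> nonbacktracking E (b # c # xs)"

lemma nonbacktracking_Cons:
  "nonbacktracking E (a # b # xs) \<longleftrightarrow>
     (a, b) \<in> E \<and> nonbacktracking E (b # xs) \<and> (xs = [] \<or> hd xs \<noteq> a)"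
  by (cases xs) auto

lemma nonbacktracking_nth:
  assumes "nonbacktracking E xs"
  shows "Suc k < length xs \<Longrightarrow> (xs ! k, xs ! Suc k) \<in> E"
    and "Suc (Suc k) < length xs \<Longrightarrow> xs ! k \<noteq> xs ! Suc (Suc k)"
  using assms
proof (induction xs arbitrary: k)
  case (Cons a xs)
  have step: "(a, hd xs) \<in> E" "nonbacktracking E xs" "length xs \<le> 1 \<or> xs ! 1 \<noteq> a" if "nonbacktracking E (a # xs)" "xs \<noteq> []"
    using that by (cases xs; auto simp: nonbacktracking_Cons hd_conv_nth)+
  {
    case 1
    then show ?case using Cons.IH(1)[of "k - 1"] step
      by (cases k; cases "xs = []") (auto simp: hd_conv_nth)
  next
    case 2
    then show ?case using Cons.IH(2)[of "k - 1"] step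
      by (cases k; cases "xs = []") (auto simp: hd_conv_nth)
  }
qed simp_all

text \<open>
  Two walks that leave the same vertex over different edges join to a single walk, the first one
  being traversed backwards.
\<close>

lemma nonbacktracking_join:
  assumes "sym E" "nonbacktracking E (a # xs)" "nonbacktracking E (a # ys)"
    and "xs = [] \<or> ys = [] \<or> hd xs \<noteq> hd ys"
  shows "nonbacktracking E (rev xs @ a # ys)"
  using assms
proof (induction xs arbitrary: a ys)
  case (Cons b xs)
  have "nonbacktracking E (b # xs)" "(b, a) \<in> E" "xs = [] \<or> hd xs \<noteq> a"
    using Cons.prems by (auto simp: nonbacktracking_Cons dest: symD)
  moreover from this have "nonbacktracking E (b # a # ys)"
    using Cons.prems by (auto simp: nonbacktracking_Cons)
  ultimately have "nonbacktracking E (rev xs @ b # a # ys)"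
    using Cons.IH[of b "a # ys"] Cons.prems(1) by auto
  then show ?case by simp
qed simp

text \<open>
  In a tree a non-backtracking walk is a path: two visits of the same vertex at the least possible
  distance \<open>d\<close> bound a cycle, so \<open>d = 2\<close>, and the walk would backtrack there.
\<close>

lemma nonbacktracking_distinct:
  assumes wf: "\<And>u v. (u, v) \<in> parcs N \<Longrightarrow> u \<in> pverts N"
    and cycles: "\<And>p. pre_digraph.cycle (with_proj N) p \<Longrightarrow> length p = 2"
    and nb: "nonbacktracking (parcs N) xs"
  shows "distinct xs"
proof (rule ccontr)
  assume "\<not> distinct xs"
  define P where "P d \<longleftrightarrow> (\<exists>a. 0 < d \<and> a + d < length xs \<and> xs ! a = xs ! (a + d))" for d
  have "\<exists>d. P d"
  proof -
    obtain a b where "a < length xs" "b < length xs" "a \<noteq> b" "xs ! a = xs ! b"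
      using \<open>\<not> distinct xs\<close> by (auto simp: distinct_conv_nth)
    then show ?thesis
      unfolding P_def
      by (metis add_diff_inverse_nat less_imp_add_positive linorder_neqE_nat)
  qed
  define d where "d = (LEAST d. P d)"
  have "P d" and least: "\<And>d'. P d' \<Longrightarrow> d \<le> d'"
    using \<open>\<exists>d. P d\<close> unfolding d_def by (auto intro: LeastI_ex Least_le)
  then obtain a where a: "0 < d" "a + d < length xs" "xs ! a = xs ! (a + d)"
    unfolding P_def by blast
  define p where "p b = map (\<lambda>k. (xs ! k, xs ! Suc k)) [b..<a + d]" for b
  have p_step: "p b = (xs ! b, xs ! Suc b) # p (Suc b)" if "b < a + d" for b
    using that by (simp add: p_def upt_conv_Cons)
  have verts: "pre_digraph.awalk_verts (with_proj N) (xs ! b) (p b) = map ((!) xs) [b..<Suc (a + d)]"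
    and cas: "pre_digraph.cas (with_proj N) (xs ! b) (p b) (xs ! (a + d))"
    if "b \<le> a + d" for b
    using that
  proof (induction "a + d - b" arbitrary: b)
    case 0
    {
      case 1 with 0 show ?case
        by (simp add: p_def pre_digraph.awalk_verts.simps)
    next
      case 2 with 0 show ?case
        by (simp add: p_def pre_digraph.cas.simps)
    }
  next
    case (Suc n)
    then have "b < a + d" "n = a + d - Suc b" by auto
    note IH = Suc.hyps(1)[OF this(2)] Suc.hyps(2)[OF this(2)]
    {
      case 1 show ?case
        using IH(1) \<open>b < a + d\<close>
        by (simp add: p_step pre_digraph.awalk_verts.simps upt_conv_Cons del: upt_Suc)
    next
      case 2 show ?case
        using IH(2) \<open>b < a + d\<close>
        by (simp add: p_step pre_digraph.cas.simps)
    }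
  qed
  have "set (p a) \<subseteq> parcs N"
    using nonbacktracking_nth(1)[OF nb] a by (auto simp: p_def)
  moreover have "xs ! a \<in> pverts N"
    using wf nonbacktracking_nth(1)[OF nb, of a] a by simp
  ultimately have walk: "pre_digraph.awalk (with_proj N) (xs ! a) (p a) (xs ! a)"
    using cas[of a] a by (simp add: pre_digraph.awalk_def)
  have "distinct (map ((!) xs) [Suc a..<Suc (a + d)])"
  proof -
    have "xs ! b \<noteq> xs ! c" if "Suc a \<le> b" "b < c" "c < Suc (a + d)" for b c
    proof
      assume "xs ! b = xs ! c"
      with that a have "P (c - b)"
        unfolding P_def by (intro exI[of _ b]) auto
      from least[OF this] that show False by linarith
    qed
    then have "inj_on ((!) xs) {Suc a..<Suc (a + d)}"
      by (auto intro!: linorder_inj_onI)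
    then show ?thesis
      by (simp add: distinct_map del: upt_Suc)
  qed
  then have "pre_digraph.cycle (with_proj N) (p a)"
    unfolding pre_digraph.cycle_def using walk verts[of a] a(1)
    by (intro exI[of _ "xs ! a"]) (auto simp: p_def map_tl[symmetric] simp del: upt_Suc)
  then have "d = 2"
    using cycles[of "p a"] by (simp add: p_def)
  then show False
    using nonbacktracking_nth(2)[OF nb, of a] a by simp
qed

section \<open>Flooding on a tree\<close>

text \<open>
  A flooding of distinct messages on an undirected tree \<open>N\<close>, that is, on a symmetric digraph in
  which every cycle runs back and forth over a single edge. Connectedness is only assumed where it
  is needed.
\<close>

locale tree_flooding =
  fixes N :: "'v pair_pre_digraph" and S :: "'v \<Rightarrow> 'm"
    and I :: "nat \<Rightarrow> 'v \<Rightarrow> 'm set" and sent :: "nat \<Rightarrow> 'v \<Rightarrow> 'v \<Rightarrow> 'm option"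
    and T :: nat
  assumes finite_verts: "finite (pverts N)"
    and arcs_in_verts: "\<And>u v. (u, v) \<in> parcs N \<Longrightarrow> u \<in> pverts N \<and> v \<in> pverts N"
    and sym_arcs: "sym (parcs N)"
    and cycle_length: "\<And>p. pre_digraph.cycle (with_proj N) p \<Longrightarrow> length p = 2"
    and inj_messages: "inj_on S (pverts N)"
    and rounds: "dsf_rounds T True N S I sent"
begin

abbreviation eligible :: "nat \<Rightarrow> 'v \<Rightarrow> 'v \<Rightarrow> 'm set" where
  "eligible \<equiv> dsf_eligible True I sent"

lemma distinct_walk: "nonbacktracking (parcs N) xs \<Longrightarrow> distinct xs"
  using nonbacktracking_distinct[of N xs] arcs_in_verts cycle_length by blast

lemma eligible_iff:
  "e \<in> eligible t i j \<longleftrightarrow>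
     e \<in> I (t - 1) i \<and> (\<forall>t'\<in>{1..<t}. sent t' i j \<noteq> Some e \<and> sent t' j i \<noteq> Some e)"
  by (simp add: dsf_eligible_def)

lemma initial: "i \<in> pverts N \<Longrightarrow> I 0 i = {S i}"
  using rounds by (simp add: dsf_rounds_def)

lemma send:
  assumes "t \<in> {1..T}" "(i, j) \<in> parcs N"
  shows sends_if_eligible: "eligible t i j \<noteq> {} \<Longrightarrow> \<exists>e\<in>eligible t i j. sent t i j = Some e"
    and sent_eligible: "sent t i j = Some e \<Longrightarrow> e \<in> eligible t i j"
proof -
  have "if eligible t i j = {} then sent t i j = None
      else \<exists>e\<in>eligible t i j. sent t i j = Some e"
    using rounds assms unfolding dsf_rounds_def by blast
  then show "eligible t i j \<noteq> {} \<Longrightarrow> \<exists>e\<in>eligible t i j. sent t i j = Some e"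
    "sent t i j = Some e \<Longrightarrow> e \<in> eligible t i j"
    by (auto split: if_splits)
qed

lemma receive:
  assumes "t \<in> {1..T}" "i \<in> pverts N"
  shows "I t i = I (t - 1) i \<union> {e. \<exists>j. (j, i) \<in> parcs N \<and> sent t j i = Some e}"
  using rounds assms unfolding dsf_rounds_def by blast

lemma held_iff:
  assumes "i \<in> pverts N" "t \<le> T"
  shows "e \<in> I t i \<longleftrightarrow>
     e = S i \<or> (\<exists>l t'. t' \<in> {1..t} \<and> (l, i) \<in> parcs N \<and> sent t' l i = Some e)"
  using assms(2)
proof (induction t)
  case 0 then show ?case using assms(1) by (simp add: initial)
next
  case (Suc t)
  have "e \<in> I (Suc t) i \<longleftrightarrow> e \<in> I t i \<or> (\<exists>l. (l, i) \<in> parcs N \<and> sent (Suc t) l i = Some e)"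
    using receive[of "Suc t" i] Suc.prems assms(1) by auto
  also have "\<dots> \<longleftrightarrow>
      e = S i \<or> (\<exists>l t'. t' \<in> {1..Suc t} \<and> (l, i) \<in> parcs N \<and> sent t' l i = Some e)"
    using Suc by (auto simp: atLeastAtMostSuc_conv)
  finally show ?case .
qed

text \<open>
  A node passes a message on over another edge than the one on which it arrived. The route of a
  message to \<open>j\<close> by way of \<open>i\<close>, read backwards, is therefore a non-backtracking walk from \<open>j\<close> to
  its origin.
\<close>

lemma eligible_origin:
  assumes "t \<in> {1..Suc T}" "(i, j) \<in> parcs N" "e \<in> eligible t i j"
  shows "\<exists>xs. nonbacktracking (parcs N) (j # i # xs) \<and> last (i # xs) \<in> pverts N \<and>
     e = S (last (i # xs))"
  using assms
proof (induction t arbitrary: i j rule: less_induct)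
  case (less t)
  note ij = less.prems(2)
  have ji: "(j, i) \<in> parcs N" and i: "i \<in> pverts N"
    using ij sym_arcs arcs_in_verts by (auto dest: symD)
  have "e \<in> I (t - 1) i" "t - 1 \<le> T"
    using less.prems by (auto simp: eligible_iff)
  then consider "e = S i"
    | l t' where "t' \<in> {1..t - 1}" "(l, i) \<in> parcs N" "sent t' l i = Some e"
    using held_iff[of i "t - 1"] i by blast
  then show ?case
  proof cases
    case 1
    then show ?thesis using ji i by (intro exI[of _ "[]"]) simp
  next
    case 2
    then have "t' \<in> {1..<t}" "t' \<in> {1..T}" using \<open>t - 1 \<le> T\<close> by auto
    have "e \<in> eligible t' l i"
      using sent_eligible \<open>t' \<in> {1..T}\<close> 2 by blast
    then obtain ys where ys: "nonbacktracking (parcs N) (i # l # ys)"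
      "last (l # ys) \<in> pverts N" "e = S (last (l # ys))"
      using less.IH[of t' l i] \<open>t' \<in> {1..<t}\<close> \<open>t' \<in> {1..T}\<close> 2 by auto
    moreover have "l \<noteq> j"
      using less.prems(3) \<open>t' \<in> {1..<t}\<close> 2 by (auto simp: eligible_iff)
    ultimately show ?thesis
      using ji by (intro exI[of _ "l # ys"]) auto
  qed
qed

text \<open>
  The elements that reach a node from different neighbours, and its own message, are pairwise
  different, as otherwise two routes from the same origin would close up to a non-backtracking walk
  with a repeated vertex.
\<close>

lemma own_message_not_received:
  assumes "t \<in> {1..T}" "(l, i) \<in> parcs N"
  shows "sent t l i \<noteq> Some (S i)"
proof
  assume "sent t l i = Some (S i)"
  then have "S i \<in> eligible t l i" using sent_eligible assms by blast
  then obtain xs where xs: "nonbacktracking (parcs N) (i # l # xs)"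
    "last (l # xs) \<in> pverts N" "S i = S (last (l # xs))"
    using eligible_origin[of t l i "S i"] assms by auto
  then have "last (l # xs) = i"
    using inj_onD[OF inj_messages xs(3)] arcs_in_verts[OF assms(2)] by blast
  then have "i \<in> set (l # xs)" by (metis last_in_set list.distinct(1))
  then show False using distinct_walk[OF xs(1)] by simp
qed

lemma received_from_one_neighbour:
  assumes "t \<in> {1..T}" "(l, i) \<in> parcs N" "sent t l i = Some e"
    and "t' \<in> {1..T}" "(j, i) \<in> parcs N" "sent t' j i = Some e"
  shows "l = j"
proof (rule ccontr)
  assume "l \<noteq> j"
  have "e \<in> eligible t l i" "e \<in> eligible t' j i"
    using sent_eligible assms by blast+
  then obtain xs ys
    where xs: "nonbacktracking (parcs N) (i # l # xs)" "last (l # xs) \<in> pverts N"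
        "e = S (last (l # xs))"
      and ys: "nonbacktracking (parcs N) (i # j # ys)" "last (j # ys) \<in> pverts N"
        "e = S (last (j # ys))"
    using eligible_origin[of t l i e] eligible_origin[of t' j i e] assms by auto
  have "distinct (rev (l # xs) @ i # j # ys)"
    by (rule distinct_walk, rule nonbacktracking_join[OF sym_arcs xs(1) ys(1)])
       (simp add: \<open>l \<noteq> j\<close>)
  then have "set (l # xs) \<inter> set (j # ys) = {}" by auto
  moreover have "last (l # xs) = last (j # ys)"
    using inj_onD[OF inj_messages] xs(2,3) ys(2,3) by metis
  ultimately show False by (metis disjoint_iff last_in_set list.distinct(1))
qed

lemma sent_once:
  assumes "t \<in> {1..T}" "t' \<in> {1..T}" "(i, j) \<in> parcs N" "sent t i j = Some e" "sent t' i j = Some e"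
  shows "t = t'"
proof -
  have *: False if "t1 < t2" "t1 \<in> {1..T}" "t2 \<in> {1..T}" "sent t1 i j = Some e" "sent t2 i j = Some e"
    for t1 t2
    using sent_eligible[OF that(3) assms(3) that(5)] that by (auto simp: eligible_iff)
  show ?thesis using *[of t t'] *[of t' t] assms by (meson linorder_neqE_nat)
qed

lemma held_mono:
  assumes "i \<in> pverts N" "t \<le> t'" "t' \<le> T" "e \<in> I t i"
  shows "e \<in> I t' i"
  using assms held_iff[of i t e] held_iff[of i t' e] by fastforce

text \<open>
  An arc that can send in some round could send in all earlier ones, so it is busy in an initial
  segment of the rounds. Suppose that \<open>i\<close> can send something to \<open>j\<close> in round \<open>t + 1\<close> that it received
  only in round \<open>t\<close>, from \<open>l\<close>. By induction \<open>l\<close> has sent to \<open>i\<close> in all rounds up to \<open>t\<close>. Before round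
  \<open>t\<close>, node \<open>i\<close> therefore held at least \<open>t\<close> elements that did not come from \<open>j\<close>, and it had sent at
  most \<open>t - 1\<close> elements to \<open>j\<close>.
\<close>

lemma eligible_prefix:
  assumes "t \<in> {1..Suc T}" "(i, j) \<in> parcs N" "eligible t i j \<noteq> {}" "t' \<in> {1..t}"
  shows "eligible t' i j \<noteq> {}"
  using assms
proof (induction t arbitrary: i j t')
  case (Suc t)
  note ij = Suc.prems(2)
  have i: "i \<in> pverts N" and ji: "(j, i) \<in> parcs N"
    using arcs_in_verts sym_arcs ij by (auto dest: symD)
  show ?case
  proof (cases "t' = Suc t")
    case True
    then show ?thesis using Suc.prems by simp
  next
    case False
    then have t: "t' \<in> {1..t}" "t \<in> {1..T}" using Suc.prems by auto
    have "eligible t i j \<noteq> {}"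
    proof -
      obtain e where e: "e \<in> eligible (Suc t) i j" using Suc.prems by blast
      show ?thesis
      proof (cases "e \<in> I (t - 1) i")
        case True
        then have "e \<in> eligible t i j" using e by (auto simp: eligible_iff)
        then show ?thesis by blast
      next
        case False
        have "e \<in> I t i" using e by (simp add: eligible_iff)
        then obtain l where l: "(l, i) \<in> parcs N" "sent t l i = Some e"
          using receive[of t i] t i False by auto
        have "l \<noteq> j" using e l t by (auto simp: eligible_iff)
        have "eligible t l i \<noteq> {}" using sent_eligible l t by blast
        then have "\<exists>e. sent q l i = Some e" if "q \<in> {1..t}" for q
          using Suc.IH[of l i q] sends_if_eligible[of q l i] that t l(1) by fastforce
        then obtain m where m: "\<And>q. q \<in> {1..t} \<Longrightarrow> sent q l i = Some (m q)"
          by metis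
        \<comment> \<open>\<open>A\<close> has \<open>t\<close> elements held before round \<open>t\<close>; \<open>B\<close> are the at most \<open>t - 1\<close> elements sent to \<open>j\<close>.\<close>
        define A where "A = insert (S i) (m ` {1..<t})"
        define B where "B = {b. \<exists>q\<in>{1..<t}. sent q i j = Some b}"
        have "inj_on m {1..<t}"
        proof (rule inj_onI)
          fix q q' assume "q \<in> {1..<t}" "q' \<in> {1..<t}" "m q = m q'"
          then show "q = q'" using sent_once[of q q' l i "m q"] m[of q] m[of q'] t l(1) by auto
        qed
        moreover have "S i \<notin> m ` {1..<t}"
        proof
          assume "S i \<in> m ` {1..<t}"
          then obtain q where "q \<in> {1..<t}" "m q = S i" by auto
          then show False using own_message_not_received[of q l i] m[of q] t l(1) by auto
        qed
        ultimately have "card A = t"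
          using t unfolding A_def by (simp add: card_image)
        moreover have "card B \<le> t - 1" "finite B"
        proof -
          have "B \<subseteq> (\<lambda>q. the (sent q i j)) ` {1..<t}" unfolding B_def by force
          then show "card B \<le> t - 1" "finite B"
            by (metis card_atLeastLessThan card_image_le card_mono finite_atLeastLessThan
                finite_imageI le_trans) (use \<open>B \<subseteq> _\<close> finite_subset in blast)
        qed
        ultimately have "\<not> A \<subseteq> B"
          using card_mono[of B A] t by fastforce
        then obtain z where z: "z \<in> A" "z \<notin> B" by blast
        have "z \<in> I (t - 1) i"
        proof -
          have "z = S i \<or> (\<exists>l t'. t' \<in> {1..t - 1} \<and> (l, i) \<in> parcs N \<and> sent t' l i = Some z)"
            using z(1) m l(1) unfolding A_def by fastforce
          then show ?thesis using held_iff[of i "t - 1" z] i t by auto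
        qed
        moreover have "sent q i j \<noteq> Some z" if "q \<in> {1..<t}" for q
          using z(2) that unfolding B_def by blast
        moreover have "sent q j i \<noteq> Some z" if "q \<in> {1..<t}" for q
        proof
          assume q: "sent q j i = Some z"
          have "z \<noteq> S i" using own_message_not_received[of q j i] q that t ji by auto
          then obtain q' where "q' \<in> {1..<t}" "z = m q'" using z(1) unfolding A_def by blast
          then have "l = j"
            using received_from_one_neighbour[of q' l i z q j] m[of q'] q that t ji l(1) by auto
          then show False using \<open>l \<noteq> j\<close> by simp
        qed
        ultimately have "z \<in> eligible t i j" by (simp add: eligible_iff)
        then show ?thesis by blast
      qed
    qed
    then show ?thesis using Suc.IH[of i j t'] t ij by auto
  qed
qed simp

text \<open>
  If the arc from \<open>i\<close> to \<open>j\<close> could still send after \<open>n - 1\<close> rounds, it would have sent in each of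
  them, and there would be \<open>n\<close> different messages that originate at nodes other than \<open>j\<close>.
\<close>

lemma nothing_left_to_send:
  assumes "Suc T = card (pverts N)" "(i, j) \<in> parcs N"
  shows "eligible (Suc T) i j = {}"
proof (rule ccontr)
  assume "eligible (Suc T) i j \<noteq> {}"
  then have "\<exists>e\<in>eligible t i j. t = Suc T \<or> sent t i j = Some e" if "t \<in> {1..Suc T}" for t
    using eligible_prefix[of "Suc T" i j t] sends_if_eligible[of t i j] assms(2) that
    by (cases "t = Suc T") auto
  then obtain m where m: "\<And>t. t \<in> {1..Suc T} \<Longrightarrow> m t \<in> eligible t i j"
    "\<And>t. t \<in> {1..T} \<Longrightarrow> sent t i j = Some (m t)"
    by (metis atLeastAtMost_iff le_SucI not_less_eq_eq)
  have neq: "m q \<noteq> m q'" if "q \<in> {1..Suc T}" "q' \<in> {1..Suc T}" "q < q'" for q q'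
    using m(1)[OF that(2)] m(2)[of q] that by (auto simp: eligible_iff)
  have "inj_on m {1..Suc T}"
    by (rule linorder_inj_onI) (use neq in auto)
  moreover have "m ` {1..Suc T} \<subseteq> S ` (pverts N - {j})"
  proof
    fix e assume "e \<in> m ` {1..Suc T}"
    then obtain q where q: "q \<in> {1..Suc T}" "e = m q" by blast
    from eligible_origin[OF q(1) assms(2) m(1)[OF q(1)]] obtain xs
      where xs: "nonbacktracking (parcs N) (j # i # xs)" "last (i # xs) \<in> pverts N"
        "e = S (last (i # xs))"
      using q by blast
    have "last (i # xs) \<noteq> j"
      using distinct_walk[OF xs(1)] by (metis distinct.simps(2) last_in_set list.distinct(1))
    then show "e \<in> S ` (pverts N - {j})" using xs by blast
  qed
  ultimately have "card {1..Suc T} \<le> card (S ` (pverts N - {j}))"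
    using finite_verts by (metis card_image card_mono finite_Diff finite_imageI)
  also have "\<dots> \<le> card (pverts N - {j})" using finite_verts by (simp add: card_image_le)
  also have "\<dots> = T" using assms arcs_in_verts[OF assms(2)] finite_verts by (simp add: card_Diff_singleton_if)
  finally show False by simp
qed

text \<open>
  Once no arc has anything left to send, the ends of each edge hold the same elements.
\<close>

theorem flooding_complete:
  assumes "Suc T = card (pverts N)" "strongly_connected (with_proj N)" "i \<in> pverts N"
  shows "I T i = S ` pverts N"
proof -
  have step: "I T u \<subseteq> I T v" if "(u, v) \<in> parcs N" for u v
  proof
    fix e assume "e \<in> I T u"
    have uv: "u \<in> pverts N" "v \<in> pverts N" "(v, u) \<in> parcs N"
      using that arcs_in_verts sym_arcs by (auto dest: symD)
    have "e \<notin> eligible (Suc T) u v" using nothing_left_to_send assms(1) that by blast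
    then obtain t where t: "t \<in> {1..T}" "sent t u v = Some e \<or> sent t v u = Some e"
      using \<open>e \<in> I T u\<close> by (auto simp: eligible_iff less_Suc_eq_le)
    from t(2) show "e \<in> I T v"
    proof
      assume "sent t u v = Some e"
      then show ?thesis using held_iff[of v T e] uv that t(1) by blast
    next
      assume "sent t v u = Some e"
      then have "e \<in> eligible t v u" using sent_eligible t(1) uv by blast
      then have "e \<in> I (t - 1) v" by (simp add: eligible_iff)
      then show ?thesis using held_mono[of v "t - 1" T e] uv t(1) by auto
    qed
  qed
  have reach: "I T u \<subseteq> I T v" if "(u, v) \<in> (parcs N)\<^sup>*" for u v
    using that by (induction rule: rtrancl_induct) (use step in blast)+
  have "S u \<in> I T i" if "u \<in> pverts N" for u
  proof -
    have "(u, i) \<in> (parcs N)\<^sup>*"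
      using assms(2,3) that reachable_rtranclI[of "with_proj N" u i]
      by (auto simp: strongly_connected_def)
    moreover have "S u \<in> I T u" using held_iff[of u T] that by blast
    ultimately show ?thesis using reach by blast
  qed
  moreover have "I T i \<subseteq> S ` pverts N"
  proof
    fix e assume "e \<in> I T i"
    then consider "e = S i" | l t where "t \<in> {1..T}" "(l, i) \<in> parcs N" "sent t l i = Some e"
      using held_iff[of i T e] assms(3) by blast
    then show "e \<in> S ` pverts N"
    proof cases
      case 2
      then have "e \<in> eligible t l i" using sent_eligible by blast
      then show ?thesis using eligible_origin[of t l i e] 2 by auto
    qed (use assms(3) in simp)
  qed
  ultimately show ?thesis by blast
qed

end

text \<open>
  On a network that is not symmetric, complete delivery is part of the definition of the flooding.
\<close>

lemma dsf_output:
  assumes fin: "finite (pverts G)"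
    and N: "dsf_network G N" and inj: "inj_on S (pverts G)"
    and dsf: "dsf G N S out" and i: "i \<in> pverts G"
  shows "out i = S ` pverts G"
proof (cases "symmetric (with_proj G)")
  case False
  then show ?thesis using N dsf i by (auto simp: dsf_network_def dsf_def)
next
  case True
  then have "undirected_spanning_tree N G" using N by (simp add: dsf_network_def)
  then have tree: "subgraph (with_proj N) (with_proj G)" "pverts N = pverts G"
    "symmetric (with_proj N)" "strongly_connected (with_proj N)"
    "\<And>p. pre_digraph.cycle (with_proj N) p \<Longrightarrow> length p = 2"
    by (auto simp: undirected_spanning_tree_def spanning_def)
  obtain T I sent where T: "dsf_rounds T True N S I sent" "\<And>i. i \<in> pverts N \<Longrightarrow> out i = I T i"
    "T = card (pverts N) - 1"
    using dsf True by (auto simp: dsf_def)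
  interpret tree_flooding N S I sent T
  proof
    show "finite (pverts N)" "inj_on S (pverts N)" using tree fin inj by auto
    show "sym (parcs N)" using tree(3) by (simp add: symmetric_def)
    show "u \<in> pverts N \<and> v \<in> pverts N" if "(u, v) \<in> parcs N" for u v
      using that tree(1) by (force simp: subgraph_def dest: wf_digraph.wellformed)
  qed (use tree T in auto)
  have "Suc T = card (pverts N)"
    using T(3) finite_verts i tree(2) by (metis One_nat_def Suc_pred card_gt_0_iff empty_iff)
  then show ?thesis
    using flooding_complete[of i] tree T i by auto
qed

section \<open>Spectral estimates\<close>

lemma outer_square_mult_vec: "outer_square h *v v = (h \<bullet> v) *\<^sub>R h"
  by (simp add: vec_eq_iff outer_square_def matrix_vector_mult_def inner_vec_def
      sum_distrib_left sum_distrib_right mult_ac)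

lemma inner_outer_square: "A \<bullet> outer_square h = h \<bullet> (A *v h)"
  by (simp add: outer_square_def matrix_vector_mult_def inner_vec_def
      sum_distrib_left mult_ac)

lemma inner_self_outer_square: "outer_square h \<bullet> outer_square h = (h \<bullet> h)\<^sup>2"
  by (simp add: inner_outer_square outer_square_mult_vec power2_eq_square)

lemma outer_square_scaleR: "outer_square (a *\<^sub>R h) = a\<^sup>2 *\<^sub>R outer_square h"
  by (simp add: vec_eq_iff outer_square_def power2_eq_square mult_ac)

lemma signed_outer_square:
  "sgn a *\<^sub>R outer_square (sqrt \<bar>a\<bar> *\<^sub>R w) = a *\<^sub>R outer_square w"
  by (simp add: outer_square_scaleR sgn_mult_abs)

text \<open>
  The norm of a matrix is its Frobenius norm.
\<close>

lemma norm_matrix_eq_columns: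
  fixes A :: "real^'p^'p"
  shows "(norm A)\<^sup>2 = (\<Sum>b\<in>UNIV. (norm (A *v axis b 1))\<^sup>2)"
proof -
  have "(norm A)\<^sup>2 = (\<Sum>a\<in>UNIV. \<Sum>b\<in>UNIV. (A $ a $ b)\<^sup>2)"
    unfolding power2_norm_eq_inner inner_vec_def by (simp add: power2_eq_square)
  also have "\<dots> = (\<Sum>b\<in>UNIV. \<Sum>a\<in>UNIV. (A $ a $ b)\<^sup>2)"
    by (rule sum.swap)
  also have "\<dots> = (\<Sum>b\<in>UNIV. (norm (A *v axis b 1))\<^sup>2)"
    unfolding power2_norm_eq_inner inner_vec_def
    by (simp add: matrix_vector_mult_basis column_def power2_eq_square)
  finally show ?thesis .
qed

context
  fixes A :: "real^'p^'p" and lam :: "nat \<Rightarrow> real" and w :: "nat \<Rightarrow> real^'p"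
  assumes eig: "eigen_by_magnitude A lam w"
begin

lemma eigenvector: "j \<in> {1..CARD('p)} \<Longrightarrow> A *v w j = lam j *\<^sub>R w j"
  and orthonormal: "\<lbrakk>j \<in> {1..CARD('p)}; l \<in> {1..CARD('p)}\<rbrakk> \<Longrightarrow> w j \<bullet> w l = (if j = l then 1 else 0)"
  using eig unfolding eigen_by_magnitude_def by blast+

lemma one_in_range: "1 \<in> {1..CARD('p)}"
  by (simp add: Suc_leI)

lemma magnitude_decreasing:
  assumes "1 \<le> l" "l \<le> j" "j \<le> CARD('p)"
  shows "\<bar>lam j\<bar> \<le> \<bar>lam l\<bar>"
  using assms(2,1,3)
proof (induction j rule: dec_induct)
  case (step j)
  have "\<bar>lam (Suc j)\<bar> \<le> \<bar>lam j\<bar>"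
    using eig step unfolding eigen_by_magnitude_def by auto
  then show ?case using step by simp
qed simp

lemma norm_orthonormal_sum:
  assumes "J \<subseteq> {1..CARD('p)}"
  shows "(norm (\<Sum>j\<in>J. a j *\<^sub>R w j))\<^sup>2 = (\<Sum>j\<in>J. (a j)\<^sup>2)"
proof -
  have fin: "finite J" using assms finite_subset by blast
  have "(norm (\<Sum>j\<in>J. a j *\<^sub>R w j))\<^sup>2 = (\<Sum>j\<in>J. \<Sum>l\<in>J. a j * (a l * (w l \<bullet> w j)))"
    by (simp add: power2_norm_eq_inner inner_sum_left inner_sum_right sum_distrib_left)
  also have "\<dots> = (\<Sum>j\<in>J. \<Sum>l\<in>J. if j = l then (a j)\<^sup>2 else 0)"
    using assms by (intro sum.cong refl) (auto simp: orthonormal subset_iff power2_eq_square)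
  also have "\<dots> = (\<Sum>j\<in>J. (a j)\<^sup>2)" using fin by simp
  finally show ?thesis .
qed

lemma eigenvector_expansion: "v = (\<Sum>j=1..CARD('p). (w j \<bullet> v) *\<^sub>R w j)"
proof -
  let ?J = "{1..CARD('p)}"
  define z where "z = v - (\<Sum>j\<in>?J. (w j \<bullet> v) *\<^sub>R w j)"
  have inj: "inj_on w ?J"
    by (rule inj_onI) (metis orthonormal zero_neq_one)
  have "0 \<notin> w ` ?J"
    using orthonormal by (metis imageE inner_zero_left zero_neq_one)
  moreover have "pairwise orthogonal (w ` ?J)"
    by (auto simp: pairwise_def orthogonal_def orthonormal)
  ultimately have "independent (w ` ?J)"
    by (rule pairwise_orthogonal_independent[rotated])
  moreover have "card (w ` ?J) = DIM(real^'p)"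
    using inj by (simp add: card_image)
  ultimately have span: "span (w ` ?J) = UNIV"
    by (metis card_eq_dim dim_UNIV finite_atLeastAtMost finite_imageI subset_UNIV top.extremum_uniqueI)
  have "orthogonal z x" if x: "x \<in> w ` ?J" for x
  proof -
    obtain l where l: "l \<in> ?J" "x = w l" using x by blast
    have "(\<Sum>j\<in>?J. (w j \<bullet> v) * (w j \<bullet> w l)) = (\<Sum>j\<in>?J. if j = l then w l \<bullet> v else 0)"
      using l by (intro sum.cong refl) (auto simp: orthonormal)
    then show ?thesis
      using l by (simp add: orthogonal_def z_def inner_diff_left inner_sum_left inner_commute[of v])
  qed
  then have "orthogonal z z"
    using span by (intro orthogonal_to_span[of z "w ` ?J"]) auto
  then show ?thesis by (simp add: orthogonal_def z_def)
qed

lemma spectral_expansion: "A *v v = (\<Sum>j=1..CARD('p). (lam j * (w j \<bullet> v)) *\<^sub>R w j)"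
proof -
  have "A *v v = A *v (\<Sum>j=1..CARD('p). (w j \<bullet> v) *\<^sub>R w j)"
    by (rule arg_cong[OF eigenvector_expansion])
  also have "\<dots> = (\<Sum>j=1..CARD('p). (w j \<bullet> v) *\<^sub>R (A *v w j))"
    by (simp add: linear_sum[OF matrix_vector_mul_linear] matrix_vector_mult_scaleR)
  also have "\<dots> = (\<Sum>j=1..CARD('p). (lam j * (w j \<bullet> v)) *\<^sub>R w j)"
    by (intro sum.cong refl) (simp add: eigenvector mult.commute)
  finally show ?thesis .
qed

lemma norm_diagonal_le:
  assumes J: "J \<subseteq> {1..CARD('p)}" and c: "\<And>j. j \<in> J \<Longrightarrow> \<bar>lam j\<bar> \<le> C" and "0 \<le> C"
  shows "norm (\<Sum>j\<in>J. (lam j * (w j \<bullet> v)) *\<^sub>R w j) \<le> C * norm v"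
proof -
  have "(norm (\<Sum>j\<in>J. (lam j * (w j \<bullet> v)) *\<^sub>R w j))\<^sup>2 = (\<Sum>j\<in>J. (lam j * (w j \<bullet> v))\<^sup>2)"
    by (rule norm_orthonormal_sum[OF J])
  also have "\<dots> \<le> (\<Sum>j\<in>J. C\<^sup>2 * (w j \<bullet> v)\<^sup>2)"
    using c by (intro sum_mono)
      (simp add: power_mult_distrib mult_right_mono abs_le_square_iff[symmetric] \<open>0 \<le> C\<close>)
  also have "\<dots> \<le> (\<Sum>j=1..CARD('p). C\<^sup>2 * (w j \<bullet> v)\<^sup>2)"
    using J by (intro sum_mono2) auto
  also have "\<dots> = C\<^sup>2 * (norm v)\<^sup>2"
    using norm_orthonormal_sum[of "{1..CARD('p)}" "\<lambda>j. w j \<bullet> v"]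
      arg_cong[OF eigenvector_expansion[of v], of norm] by (simp add: sum_distrib_left)
  finally have "(norm (\<Sum>j\<in>J. (lam j * (w j \<bullet> v)) *\<^sub>R w j))\<^sup>2 \<le> (C * norm v)\<^sup>2"
    unfolding power_mult_distrib .
  moreover have "0 \<le> C * norm v" using \<open>0 \<le> C\<close> by simp
  ultimately show ?thesis by (rule power2_le_imp_le)
qed

lemma norm_mult_le_first: "norm (A *v v) \<le> \<bar>lam 1\<bar> * norm v"
  unfolding spectral_expansion
  by (rule norm_diagonal_le) (auto intro: magnitude_decreasing)

text \<open>
  With the leading eigencomponent removed, the operator norm is at most the magnitude of the second
  eigenvalue, which is 0 by convention in dimension one.
\<close>

lemma norm_deflated_mult_le: "norm ((A - lam 1 *\<^sub>R outer_square (w 1)) *v v) \<le> \<bar>lam 2\<bar> * norm v"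
proof -
  have "(A - lam 1 *\<^sub>R outer_square (w 1)) *v v = (\<Sum>j\<in>{1..CARD('p)} - {1}. (lam j * (w j \<bullet> v)) *\<^sub>R w j)"
    using one_in_range
    by (simp add: matrix_vector_mult_diff_rdistrib scaleR_matrix_vector_assoc[symmetric]
        outer_square_mult_vec spectral_expansion sum_diff1)
  also have "norm \<dots> \<le> \<bar>lam 2\<bar> * norm v"
    by (rule norm_diagonal_le) (auto intro!: magnitude_decreasing)
  finally show ?thesis .
qed

lemma second_le_norm: "\<bar>lam 2\<bar> \<le> norm A"
proof -
  have "\<bar>lam 2\<bar> \<le> \<bar>lam 1\<bar>"
  proof (cases "CARD('p) \<ge> 2")
    case False
    then show ?thesis using eig unfolding eigen_by_magnitude_def by simp
  qed (simp add: magnitude_decreasing)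
  also have "\<bar>lam 1\<bar> = \<bar>A \<bullet> outer_square (w 1)\<bar>"
    using one_in_range by (simp add: inner_outer_square eigenvector orthonormal)
  also have "\<dots> \<le> norm A * norm (outer_square (w 1))"
    by (rule Cauchy_Schwarz_ineq2)
  also have "norm (outer_square (w 1)) = 1"
    using one_in_range by (simp add: norm_eq_sqrt_inner inner_self_outer_square orthonormal)
  finally show ?thesis by simp
qed

text \<open>
  The squared Frobenius norm is the sum of the squared eigenvalues, so the leading one accounts for
  at least a fraction \<open>1 / p\<close> of it.
\<close>

lemma norm_deflated:
  "(norm (A - lam 1 *\<^sub>R outer_square (w 1)))\<^sup>2 \<le> (1 - 1 / CARD('p)) * (norm A)\<^sup>2"
proof -
  define B where "B = outer_square (w 1)"
  have AB: "A \<bullet> B = lam 1" and BB: "B \<bullet> B = 1"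
    using one_in_range unfolding B_def
    by (simp_all add: inner_outer_square inner_self_outer_square eigenvector orthonormal
        outer_square_mult_vec)
  have "(norm (A - lam 1 *\<^sub>R B))\<^sup>2 = A \<bullet> A - 2 * lam 1 * (A \<bullet> B) + (lam 1)\<^sup>2 * (B \<bullet> B)"
    unfolding power2_norm_eq_inner
    by (simp add: inner_diff_left inner_diff_right inner_commute[of B A] power2_eq_square algebra_simps)
  then have "(norm (A - lam 1 *\<^sub>R B))\<^sup>2 = (norm A)\<^sup>2 - (lam 1)\<^sup>2"
    by (simp only: AB BB power2_norm_eq_inner) (simp add: power2_eq_square)
  moreover
  have "(norm A)\<^sup>2 \<le> CARD('p) * (lam 1)\<^sup>2"
  proof -
    have "(norm A)\<^sup>2 \<le> (\<Sum>b\<in>(UNIV::'p set). (lam 1)\<^sup>2)"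
      unfolding norm_matrix_eq_columns
    proof (rule sum_mono)
      fix b :: 'p
      show "(norm (A *v axis b 1))\<^sup>2 \<le> (lam 1)\<^sup>2"
        using norm_mult_le_first[of "axis b 1"] by (simp add: abs_le_square_iff[symmetric])
    qed
    then show ?thesis by simp
  qed
  then have "(norm A)\<^sup>2 / CARD('p) \<le> (lam 1)\<^sup>2"
    by (simp add: pos_divide_le_eq mult.commute)
  ultimately show ?thesis unfolding B_def by (simp add: left_diff_distrib)
qed

end

section \<open>Newton steps with an approximate Hessian\<close>

lemma gradient_eqI:
  assumes "GDERIV f x :> D"
  shows "gradient f x = D"
  unfolding gradient_def
proof (rule the_equality)
  show "GDERIV f x :> D" by (rule assms)
next
  fix E assume "GDERIV f x :> E"
  then have "(\<lambda>h. h \<bullet> E) = (\<lambda>h. h \<bullet> D)"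
    using assms has_derivative_unique unfolding gderiv_def by blast
  then have "h \<bullet> (E - D) = 0" for h
    by (simp add: inner_diff_right fun_eq_iff)
  from this[of "E - D"] show "E = D" by simp
qed

lemma gderiv_gradient:
  fixes f :: "'a::euclidean_space \<Rightarrow> real"
  assumes "f differentiable (at x)"
  shows "GDERIV f x :> gradient f x"
proof -
  obtain f' where f': "(f has_derivative f') (at x)"
    using assms by (auto simp: differentiable_def)
  then interpret f': linear f' by (rule has_derivative_linear)
  have "f' = (\<lambda>h. h \<bullet> (\<Sum>b\<in>Basis. f' b *\<^sub>R b))"
  proof
    fix h
    have "f' h = f' (\<Sum>b\<in>Basis. (h \<bullet> b) *\<^sub>R b)" by (simp add: euclidean_representation)
    also have "\<dots> = h \<bullet> (\<Sum>b\<in>Basis. f' b *\<^sub>R b)"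
      by (simp add: f'.sum f'.scaleR inner_sum_right mult.commute)
    finally show "f' h = h \<bullet> (\<Sum>b\<in>Basis. f' b *\<^sub>R b)" .
  qed
  then have "GDERIV f x :> (\<Sum>b\<in>Basis. f' b *\<^sub>R b)"
    using f' unfolding gderiv_def by metis
  then show ?thesis using gradient_eqI by metis
qed

lemma has_derivative_gradient:
  assumes "twice_continuously_differentiable f"
  shows "(gradient f has_derivative (\<lambda>v. hessian f x *v v)) (at x)"
  using assms jacobian_works unfolding twice_continuously_differentiable_def hessian_def by blast

lemma gradient_sum:
  fixes f :: "'i \<Rightarrow> real^'p \<Rightarrow> real"
  assumes "\<And>j. j \<in> J \<Longrightarrow> twice_continuously_differentiable (f j)"
  shows "gradient (\<lambda>y. \<Sum>j\<in>J. f j y) x = (\<Sum>j\<in>J. gradient (f j) x)"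
proof (rule gradient_eqI)
  have "GDERIV (f j) x :> gradient (f j) x" if "j \<in> J" for j
    using gderiv_gradient assms[OF that] unfolding twice_continuously_differentiable_def by blast
  then show "GDERIV (\<lambda>y. \<Sum>j\<in>J. f j y) x :> (\<Sum>j\<in>J. gradient (f j) x)"
    unfolding gderiv_def inner_sum_right by (intro has_derivative_sum)
qed

lemma sum_matrix_vector_mult: "(\<Sum>j\<in>J. A j) *v v = (\<Sum>j\<in>J. A j *v v)"
  for A :: "'i \<Rightarrow> real^'p^'q"
  by (induction J rule: infinite_finite_induct) (auto simp: matrix_vector_mult_add_rdistrib)

lemma hessian_sum:
  fixes f :: "'i \<Rightarrow> real^'p \<Rightarrow> real"
  assumes f: "\<And>j. j \<in> J \<Longrightarrow> twice_continuously_differentiable (f j)"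
    and F: "twice_continuously_differentiable (\<lambda>y. \<Sum>j\<in>J. f j y)"
  shows "hessian (\<lambda>y. \<Sum>j\<in>J. f j y) x = (\<Sum>j\<in>J. hessian (f j) x)"
proof -
  have "gradient (\<lambda>y. \<Sum>j\<in>J. f j y) = (\<lambda>x. \<Sum>j\<in>J. gradient (f j) x)"
    by (rule ext) (rule gradient_sum[OF f])
  moreover
  have "(gradient (f j) has_derivative (\<lambda>v. hessian (f j) x *v v)) (at x)" if "j \<in> J" for j
    by (rule has_derivative_gradient) (rule f[OF that])
  then have "((\<lambda>x. \<Sum>j\<in>J. gradient (f j) x) has_derivative (\<lambda>v. \<Sum>j\<in>J. hessian (f j) x *v v)) (at x)"
    by (intro has_derivative_sum)
  ultimately have "(gradient (\<lambda>y. \<Sum>j\<in>J. f j y) has_derivative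
      (\<lambda>v. \<Sum>j\<in>J. hessian (f j) x *v v)) (at x)"
    by simp
  from has_derivative_unique[OF has_derivative_gradient[OF F] this]
  have "(\<lambda>v. hessian (\<lambda>y. \<Sum>j\<in>J. f j y) x *v v) = (\<lambda>v. \<Sum>j\<in>J. hessian (f j) x *v v)" .
  then show ?thesis
    by (simp add: matrix_eq sum_matrix_vector_mult fun_eq_iff)
qed

lemma matrix_inv_inverse:
  assumes "invertible A"
  shows "A ** matrix_inv A = mat 1"
  using assms unfolding invertible_def matrix_inv_def by (rule someI2_ex) blast

text \<open>
  A \<open>\<mu>\<close>-strongly convex objective whose Hessian is \<open>L\<close>-Lipschitz in the spectral norm.
\<close>

locale strongly_convex_problem =
  fixes F :: "real^'p \<Rightarrow> real" and \<mu> L :: real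
  assumes smooth: "twice_continuously_differentiable F"
    and mu_pos: "\<mu> > 0"
    and strongly_convex: "\<And>y. loewner_le (\<mu> *\<^sub>R mat 1) (hessian F y)"
    and L_pos: "L > 0"
    and lipschitz: "\<And>y z. spectral_norm (hessian F y - hessian F z) \<le> L * norm (y - z)"
begin

lemma hessian_coercive: "\<mu> * (norm v)\<^sup>2 \<le> v \<bullet> (hessian F y *v v)"
proof -
  have "0 \<le> v \<bullet> ((hessian F y - \<mu> *\<^sub>R mat 1) *v v)"
    using strongly_convex by (simp add: loewner_le_def)
  then show ?thesis
    by (simp add: matrix_vector_mult_diff_rdistrib scaleR_matrix_vector_assoc[symmetric]
        inner_diff_right power2_norm_eq_inner)
qed

lemma gradient_strongly_monotone:
  "\<mu> * (norm (y - z))\<^sup>2 \<le> (y - z) \<bullet> (gradient F y - gradient F z)"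
proof -
  define d where "d = y - z"
  define q where "q t = d \<bullet> gradient F (z + t *\<^sub>R d)" for t :: real
  have q': "(q has_real_derivative d \<bullet> (hessian F (z + t *\<^sub>R d) *v d)) (at t)" for t
  proof -
    have "((\<lambda>t. z + t *\<^sub>R d) has_derivative (\<lambda>s. s *\<^sub>R d)) (at t)"
      by (auto intro!: derivative_eq_intros)
    from has_derivative_compose[OF this has_derivative_gradient[OF smooth]]
    have "((\<lambda>t. gradient F (z + t *\<^sub>R d)) has_derivative
        (\<lambda>s. hessian F (z + t *\<^sub>R d) *v (s *\<^sub>R d))) (at t)" .
    then have "(q has_derivative (\<lambda>s. d \<bullet> (hessian F (z + t *\<^sub>R d) *v (s *\<^sub>R d)))) (at t)"
      unfolding q_def by (rule has_derivative_inner_right)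
    then show ?thesis
      by (simp add: has_field_derivative_def matrix_vector_mult_scaleR mult_commute_abs)
  qed
  obtain t where "q 1 - q 0 = (1 - 0) * (d \<bullet> (hessian F (z + t *\<^sub>R d) *v d))"
    using MVT2[of 0 1 q "\<lambda>t. d \<bullet> (hessian F (z + t *\<^sub>R d) *v d)"] q' by auto
  then have "\<mu> * (norm d)\<^sup>2 \<le> q 1 - q 0"
    using hessian_coercive by simp
  then show ?thesis by (simp add: q_def d_def inner_diff_right)
qed

text \<open>
  The sharp constant is \<open>L / 2\<close>; the mean value inequality gives \<open>L\<close>, which is good enough for the
  step size used here.
\<close>

lemma gradient_remainder:
  "norm (gradient F z - gradient F y - hessian F y *v (z - y)) \<le> L * (norm (z - y))\<^sup>2"
proof -
  define q where "q u = gradient F u - hessian F y *v u" for u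
  have "norm (q z - q y) \<le> (L * norm (z - y)) * norm (z - y)"
  proof (rule differentiable_bound)
    show "convex (closed_segment y z)" by (rule convex_closed_segment)
    fix u assume u: "u \<in> closed_segment y z"
    show "(q has_derivative (\<lambda>v. (hessian F u - hessian F y) *v v)) (at u within closed_segment y z)"
      unfolding q_def matrix_vector_mult_diff_rdistrib
      by (intro has_derivative_diff has_derivative_at_withinI[OF has_derivative_gradient[OF smooth]]
          bounded_linear_imp_has_derivative) (simp add: linear_linear)
    have "onorm ((*v) (hessian F u - hessian F y)) \<le> L * norm (u - y)"
      using lipschitz[of u y] by (simp add: spectral_norm_def)
    also have "\<dots> \<le> L * norm (z - y)"
      using u L_pos segment_bound(1)[of u y z] by simp
    finally show "onorm ((*v) (hessian F u - hessian F y)) \<le> L * norm (z - y)" .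
  qed simp_all
  moreover have "q z - q y = gradient F z - gradient F y - hessian F y *v (z - y)"
    by (simp add: q_def matrix_vector_mult_diff_distrib)
  ultimately show ?thesis by (simp add: power2_eq_square mult.assoc)
qed

lemma gradient_at_minimizer:
  assumes "is_arg_min F (\<lambda>_. True) xstar"
  shows "gradient F xstar = 0"
proof -
  have "F differentiable (at xstar)"
    using smooth by (simp add: twice_continuously_differentiable_def)
  then have "(F has_derivative (\<lambda>h. h \<bullet> gradient F xstar)) (at xstar)"
    using gderiv_gradient unfolding gderiv_def by blast
  then have "(\<lambda>h. h \<bullet> gradient F xstar) = (\<lambda>h. 0)"
  proof (rule has_derivative_local_min)
    show "\<forall>\<^sub>F y in at xstar. F xstar \<le> F y"
      using assms by (auto simp: is_arg_min_linorder)
  qed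
  then have "gradient F xstar \<bullet> gradient F xstar = 0" by metis
  then show ?thesis by simp
qed

lemma norm_error_le_norm_gradient:
  assumes "is_arg_min F (\<lambda>_. True) xstar"
  shows "norm (y - xstar) \<le> norm (gradient F y) / \<mu>"
proof (cases "y = xstar")
  case False
  have "\<mu> * (norm (y - xstar))\<^sup>2 \<le> (y - xstar) \<bullet> gradient F y"
    using gradient_strongly_monotone[of y xstar] gradient_at_minimizer[OF assms] by simp
  also have "\<dots> \<le> norm (y - xstar) * norm (gradient F y)"
    by (rule norm_cauchy_schwarz)
  finally have "\<mu> * norm (y - xstar) \<le> norm (gradient F y)"
    using False by (simp add: power2_eq_square mult.left_commute[of \<mu>])
  then show ?thesis using mu_pos by (simp add: pos_le_divide_eq mult.commute)
qed (use mu_pos in simp)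

text \<open>
  A damped Newton step with an approximate Hessian \<open>H\<close>. No symmetry of the matrices is needed:
  coercivity of the Hessian gives \<open>(\<mu> - r) * norm v \<le> norm (H *v v)\<close>, so \<open>H\<close> is invertible.
\<close>

lemma approximate_newton_step:
  fixes H :: "real^'p^'p"
  assumes approx: "\<And>v. norm ((hessian F y - H) *v v) \<le> r * norm v"
    and r: "r < \<mu>" and \<alpha>: "0 \<le> \<alpha>" "\<alpha> \<le> 1"
  defines "d \<equiv> matrix_inv H *v gradient F y"
  shows "norm d \<le> norm (gradient F y) / (\<mu> - r)"
    and "norm (gradient F (y - \<alpha> *\<^sub>R d)) \<le>
      (1 - \<alpha>) * norm (gradient F y) + \<alpha> * (r * norm d) + L * (\<alpha> * norm d)\<^sup>2"
proof -
  let ?g = "gradient F y" and ?B = "hessian F y"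
  have lower: "(\<mu> - r) * norm v \<le> norm (H *v v)" for v
  proof (cases "v = 0")
    case False
    have "\<mu> * (norm v)\<^sup>2 \<le> v \<bullet> (H *v v) + v \<bullet> ((?B - H) *v v)"
      using hessian_coercive[of v y]
      by (simp add: matrix_vector_mult_diff_rdistrib inner_diff_right)
    also have "\<dots> \<le> norm v * norm (H *v v) + norm v * (r * norm v)"
      by (intro add_mono order_trans[OF norm_cauchy_schwarz] mult_left_mono approx) simp_all
    finally have "norm v * ((\<mu> - r) * norm v) \<le> norm v * norm (H *v v)"
      by (simp add: power2_eq_square algebra_simps)
    then show ?thesis using False by simp
  qed simp
  have "inj ((*v) H)"
  proof (rule injI)
    fix u v assume "H *v u = H *v v"
    then have "(\<mu> - r) * norm (u - v) \<le> 0"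
      using lower[of "u - v"] by (simp add: matrix_vector_mult_diff_distrib)
    then show "u = v" using r by (simp add: mult_le_0_iff)
  qed
  then have "invertible H"
    by (simp add: invertible_left_inverse matrix_left_invertible_injective)
  then have Hd: "H *v d = ?g"
    by (simp add: d_def matrix_vector_mul_assoc matrix_inv_inverse)
  then show "norm d \<le> norm ?g / (\<mu> - r)"
    using lower[of d] r by (simp add: pos_le_divide_eq mult.commute)
  define z where "z = y - \<alpha> *\<^sub>R d"
  have zy: "z - y = - (\<alpha> *\<^sub>R d)" by (simp add: z_def)
  have "?B *v (z - y) = - (\<alpha> *\<^sub>R (?B *v d))"
    by (simp add: zy matrix_vector_mult_scaleR linear_neg[OF matrix_vector_mul_linear])
  then have eq: "gradient F z = (gradient F z - ?g - ?B *v (z - y)) + (1 - \<alpha>) *\<^sub>R ?g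
      - \<alpha> *\<^sub>R ((?B - H) *v d)"
    by (simp add: matrix_vector_mult_diff_rdistrib Hd algebra_simps)
  have triangle: "norm (a + b - c) \<le> norm a + norm b + norm c" for a b c :: "real^'p"
    using norm_triangle_ineq4[of "a + b" c] norm_triangle_ineq[of a b] by linarith
  have "norm (gradient F z) \<le> norm (gradient F z - ?g - ?B *v (z - y))
      + norm ((1 - \<alpha>) *\<^sub>R ?g) + norm (\<alpha> *\<^sub>R ((?B - H) *v d))"
    by (rule ord_eq_le_trans[OF arg_cong[OF eq, of norm] triangle])
  also have "\<dots> \<le> L * (\<alpha> * norm d)\<^sup>2 + (1 - \<alpha>) * norm ?g + \<alpha> * (r * norm d)"
    using gradient_remainder[of z y] approx[of d] \<alpha>
    by (intro add_mono) (simp_all add: zy mult_left_mono)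
  finally show "norm (gradient F (y - \<alpha> *\<^sub>R d)) \<le>
      (1 - \<alpha>) * norm ?g + \<alpha> * (r * norm d) + L * (\<alpha> * norm d)\<^sup>2"
    by (simp add: z_def)
qed

end

section \<open>Superlinear convergence\<close>

text \<open>
  The threshold \<open>r\<close> is the positive root of \<open>3 * r\<^sup>2 + 2 * (M + c) * r = \<mu>\<^sup>2\<close>. This makes \<open>\<phi>\<close>
  positive: up to a positive factor it equals \<open>\<mu> * (\<mu> - r) - r * (M + \<mu>)\<close>, which is
  \<open>r * (3 * r + M + 2 * c - 2 * \<mu>)\<close> by that equation, and
  \<open>3 * r + M + c = sqrt ((M + c)\<^sup>2 + 3 * \<mu>\<^sup>2) \<ge> 2 * \<mu>\<close>.
\<close>

lemma step_constants:
  fixes \<mu> L M c :: real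
  assumes "0 < \<mu>" "\<mu> \<le> M" "0 < L" "0 < c"
  shows "0 < r_under \<mu> M c" and "3 * r_under \<mu> M c < \<mu>" and "0 < step_const \<mu> L M c"
    and "L * step_const \<mu> L M c \<le> (\<mu> - r_under \<mu> M c) * (\<mu> - 3 * r_under \<mu> M c)"
proof -
  define m s r where "m = M + c" and "s = sqrt (m\<^sup>2 + 3 * \<mu>\<^sup>2)" and "r = r_under \<mu> M c"
  have r: "3 * r = s - m"
    unfolding r_def r_under_def m_def[symmetric] s_def[symmetric] by simp
  have s: "s\<^sup>2 = m\<^sup>2 + 3 * \<mu>\<^sup>2" "0 \<le> s" by (simp_all add: s_def)
  have m: "\<mu> < m" using assms by (simp add: m_def)
  have "m < s" unfolding s_def using assms m by (intro real_less_rsqrt) simp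
  then have r_pos: "0 < r" using r by simp
  have "s < m + \<mu>" unfolding s_def
  proof (rule real_less_lsqrt)
    have "\<mu> * \<mu> < m * \<mu>" using m assms by simp
    then show "m\<^sup>2 + 3 * \<mu>\<^sup>2 < (m + \<mu>)\<^sup>2" by (simp add: power2_sum) (simp add: power2_eq_square)
  qed (use m assms in simp_all)
  then have r_less: "3 * r < \<mu>" using r by simp
  have "2 * \<mu> \<le> s" unfolding s_def
    using m assms power_mono[of \<mu> m 2] by (intro real_le_rsqrt) (simp add: power_mult_distrib)
  then have "0 < r * (3 * r + M + 2 * c - 2 * \<mu>)"
    using r_pos assms r by (simp add: m_def)
  also have "\<dots> = \<mu>\<^sup>2 - r * (M + 2 * \<mu>)"
  proof -
    have "(3 * r + m)\<^sup>2 = m\<^sup>2 + 3 * \<mu>\<^sup>2" using s r by simp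
    then have "9 * r\<^sup>2 + 6 * (m * r) = 3 * \<mu>\<^sup>2"
      by (simp add: power2_sum power_mult_distrib mult.commute)
    then have "3 * r\<^sup>2 + 2 * (m * r) = \<mu>\<^sup>2" by linarith
    then show ?thesis by (simp add: m_def power2_eq_square algebra_simps)
  qed
  also have "\<dots> = \<mu> * (\<mu> - r) - r * (M + \<mu>)" by (simp add: power2_eq_square algebra_simps)
  finally have bracket: "0 < \<mu> * (\<mu> - r) / (M + \<mu>) - r"
    using assms by (simp add: pos_less_divide_eq)
  have \<phi>: "L * step_const \<mu> L M c = 2 * (\<mu> - r) * (\<mu> * (\<mu> - r) / (M + \<mu>) - r)"
  proof -
    have "L * (2 * \<mu> * D\<^sup>2 / (L * (M + \<mu>)) - 2 * r * D / L) = 2 * D * (\<mu> * D / (M + \<mu>) - r)" for D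
      using assms by (simp add: power2_eq_square right_diff_distrib)
    then show ?thesis unfolding step_const_def r_def[symmetric] .
  qed
  also have "0 < \<dots>" using bracket r_less r_pos by simp
  finally have \<phi>_pos: "0 < step_const \<mu> L M c" using assms by (simp add: zero_less_mult_iff)
  have "\<mu> * (\<mu> - r) \<le> (\<mu> - r) / 2 * (M + \<mu>)"
  proof -
    have "\<mu> * (\<mu> - r) \<le> (M + \<mu>) / 2 * (\<mu> - r)"
      using assms r_less r_pos by (intro mult_right_mono) auto
    then show ?thesis by (simp add: mult.commute)
  qed
  then have "\<mu> * (\<mu> - r) / (M + \<mu>) \<le> (\<mu> - r) / 2"
    using assms by (simp add: pos_divide_le_eq)
  then have "2 * (\<mu> - r) * (\<mu> * (\<mu> - r) / (M + \<mu>) - r) \<le> 2 * (\<mu> - r) * ((\<mu> - r) / 2 - r)"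
    using r_less r_pos by (intro mult_left_mono) auto
  also have "\<dots> = (\<mu> - r) * (\<mu> - 3 * r)" by (simp add: field_simps)
  finally have "L * step_const \<mu> L M c \<le> (\<mu> - r) * (\<mu> - 3 * r)" using \<phi> by simp
  with r_pos r_less \<phi>_pos show "0 < r_under \<mu> M c" "3 * r_under \<mu> M c < \<mu>" "0 < step_const \<mu> L M c"
    "L * step_const \<mu> L M c \<le> (\<mu> - r_under \<mu> M c) * (\<mu> - 3 * r_under \<mu> M c)"
    by (simp_all add: r_def)
qed

lemma perturbed_contraction_tendsto_0:
  fixes e \<delta> :: "nat \<Rightarrow> real"
  assumes "\<And>k. 0 \<le> e k" "\<And>k. e (Suc k) \<le> \<rho> * e k + \<delta> k" "0 \<le> \<rho>" "\<rho> < 1"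
    and "\<delta> \<longlonglongrightarrow> 0"
  shows "e \<longlonglongrightarrow> 0"
proof (rule LIMSEQ_I)
  fix \<epsilon> :: real assume "0 < \<epsilon>"
  define \<eta> where "\<eta> = \<epsilon> / 2"
  have "0 < \<eta> * (1 - \<rho>)" using \<open>0 < \<epsilon>\<close> assms by (simp add: \<eta>_def)
  from LIMSEQ_D[OF assms(5) this] obtain K where K: "\<And>k. K \<le> k \<Longrightarrow> \<delta> k \<le> \<eta> * (1 - \<rho>)"
    by fastforce
  have bound: "e (K + m) \<le> \<rho> ^ m * e K + \<eta>" for m
  proof (induction m)
    case 0 then show ?case using \<open>0 < \<epsilon>\<close> by (simp add: \<eta>_def)
  next
    case (Suc m)
    have "e (K + Suc m) \<le> \<rho> * e (K + m) + \<eta> * (1 - \<rho>)"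
      using assms(2)[of "K + m"] K[of "K + m"] by simp
    also have "\<dots> \<le> \<rho> * (\<rho> ^ m * e K + \<eta>) + \<eta> * (1 - \<rho>)"
      using Suc assms(3) by (intro add_right_mono mult_left_mono)
    also have "\<dots> = \<rho> ^ Suc m * e K + \<eta>" by (simp add: algebra_simps)
    finally show ?case .
  qed
  have "(\<lambda>m. \<rho> ^ m * e K) \<longlonglongrightarrow> 0"
    using LIMSEQ_realpow_zero[OF assms(3,4)] by (rule tendsto_mult_left_zero)
  from LIMSEQ_D[OF this, of \<eta>] \<open>0 < \<epsilon>\<close> obtain m0 where m0: "\<And>m. m0 \<le> m \<Longrightarrow> \<bar>\<rho> ^ m * e K\<bar> < \<eta>"
    by (auto simp: \<eta>_def)
  show "\<exists>k0. \<forall>k\<ge>k0. norm (e k - 0) < \<epsilon>"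
  proof (intro exI allI impI)
    fix k assume "K + m0 \<le> k"
    then have "e k \<le> \<rho> ^ (k - K) * e K + \<eta>" "\<bar>\<rho> ^ (k - K) * e K\<bar> < \<eta>"
      using bound[of "k - K"] m0[of "k - K"] by auto
    then have "e k < \<epsilon>" unfolding \<eta>_def by linarith
    then show "norm (e k - 0) < \<epsilon>" using assms(1)[of k] by simp
  qed
qed

text \<open>
  The factors of the majorant are kept away from 0 by taking the maximum with \<open>1 / (k + 1)\<close>, since a
  superlinearly convergent sequence may reach its limit in finitely many steps while the majorant
  has to stay nonzero.
\<close>

lemma converges_superlinearlyI:
  fixes \<epsilon> a q :: "nat \<Rightarrow> real"
  assumes bound: "\<And>k. \<bar>\<epsilon> k\<bar> \<le> a k"
    and ratio: "\<And>k. K \<le> k \<Longrightarrow> a (Suc k) \<le> q k * a k"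
    and q: "q \<longlonglongrightarrow> 0"
  shows "converges_superlinearly \<epsilon>"
proof -
  define p where "p k = max (q k) (inverse (real (Suc k)))" for k
  have p_pos: "0 < p k" for k by (simp add: p_def less_max_iff_disj)
  have "p \<longlonglongrightarrow> max 0 0"
    unfolding p_def by (intro tendsto_max q LIMSEQ_inverse_real_of_nat)
  then have p: "p \<longlonglongrightarrow> 0" by simp
  have a_nonneg: "0 \<le> a k" for k using bound[of k] by linarith
  define P where "P k = (\<Prod>j<k. p j)" for k
  have P_pos: "0 < P k" for k unfolding P_def by (intro prod_pos) (simp add: p_pos)
  have P_Suc: "P (Suc k) = p k * P k" for k by (simp add: P_def mult.commute)
  \<comment> \<open>\<open>B\<close> makes the majorant large enough up to the index from which on the ratios are controlled.\<close>
  define B where "B = 1 + (\<Sum>k\<le>K. a k / P k)"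
  have "0 < B" unfolding B_def using a_nonneg P_pos
    by (intro add_pos_nonneg sum_nonneg divide_nonneg_pos) simp_all
  have initial: "a k \<le> B * P k" if "k \<le> K" for k
  proof -
    have "a k / P k \<le> (\<Sum>k\<le>K. a k / P k)"
      using that a_nonneg P_pos by (intro member_le_sum) (auto intro: divide_nonneg_pos)
    then have "a k / P k \<le> B" by (simp add: B_def)
    then show ?thesis using P_pos[of k] by (simp add: pos_divide_le_eq)
  qed
  have dominated: "a k \<le> B * P k" for k
  proof (induction k)
    case (Suc k)
    show ?case
    proof (cases "Suc k \<le> K")
      case False
      then have "a (Suc k) \<le> q k * a k" using ratio by simp
      also have "\<dots> \<le> p k * a k" using a_nonneg by (intro mult_right_mono) (simp_all add: p_def)
      also have "\<dots> \<le> p k * (B * P k)" using Suc p_pos[of k] by (intro mult_left_mono) simp_all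
      also have "\<dots> = B * P (Suc k)" by (simp add: P_Suc)
      finally show ?thesis .
    qed (rule initial)
  qed (rule initial, simp)
  have "q_superlinear (\<lambda>k. B * P k)"
    unfolding q_superlinear_def
  proof (intro conjI allI)
    obtain k0 where k0: "\<And>k. k0 \<le> k \<Longrightarrow> p k \<le> 1 / 2"
      using LIMSEQ_D[OF p, of "1 / 2"] by fastforce
    have "summable (\<lambda>k. B * P k)"
    proof (rule summable_ratio_test[of "1 / 2" k0])
      show "norm (B * P (Suc k)) \<le> 1 / 2 * norm (B * P k)" if "k0 \<le> k" for k
      proof -
        have "p k * (B * P k) \<le> 1 / 2 * (B * P k)"
          using k0[OF that] \<open>0 < B\<close> P_pos[of k] by (intro mult_right_mono) simp_all
        then show ?thesis
          using \<open>0 < B\<close> P_pos[of k] p_pos[of k] by (simp add: P_Suc abs_mult mult.left_commute)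
      qed
    qed simp
    then show "(\<lambda>k. B * P k) \<longlonglongrightarrow> 0" by (rule summable_LIMSEQ_zero)
    have "\<bar>B * P (Suc k)\<bar> / \<bar>B * P k\<bar> = p k" for k
      using \<open>0 < B\<close> P_pos[of k] p_pos[of k] by (simp add: P_Suc abs_mult)
    then show "(\<lambda>k. \<bar>B * P (Suc k)\<bar> / \<bar>B * P k\<bar>) \<longlonglongrightarrow> 0" using p by simp
    show "B * P k \<noteq> 0" for k using \<open>0 < B\<close> P_pos[of k] by simp
  qed
  moreover have "\<bar>\<epsilon> k\<bar> \<le> \<bar>B * P k\<bar>" for k
    using bound[of k] dominated[of k] by linarith
  ultimately show ?thesis unfolding converges_superlinearly_def by blast
qed

text \<open>
  The matrices \<open>H k\<close> track a convergent sequence \<open>A k\<close>: each step contracts the Frobenius norm of the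
  error by a fixed factor below 1, up to the increment of \<open>A\<close>, which tends to 0.
\<close>

lemma rank_one_tracking:
  fixes A H :: "nat \<Rightarrow> real^'p^'p" and lam :: "nat \<Rightarrow> nat \<Rightarrow> real"
  assumes eig: "\<And>k. eigen_by_magnitude (A k - H k) (lam k) (w k)"
    and update: "\<And>k. H (Suc k) = H k + lam k 1 *\<^sub>R outer_square (w k 1)"
    and lim: "A \<longlonglongrightarrow> A'"
  shows "(\<lambda>k. \<bar>lam k 2\<bar>) \<longlonglongrightarrow> 0"
proof -
  define \<rho> where "\<rho> = sqrt (1 - 1 / CARD('p))"
  have \<rho>: "0 \<le> \<rho>" "\<rho> < 1" "\<rho>\<^sup>2 = 1 - 1 / CARD('p)"
    by (simp_all add: \<rho>_def Suc_leI)
  have "(\<lambda>k. norm (A k - H k)) \<longlonglongrightarrow> 0"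
  proof (rule perturbed_contraction_tendsto_0[where \<rho> = \<rho> and \<delta> = "\<lambda>k. norm (A (Suc k) - A k)"])
    fix k
    let ?D = "A k - H k - lam k 1 *\<^sub>R outer_square (w k 1)"
    have "(norm ?D)\<^sup>2 \<le> (\<rho> * norm (A k - H k))\<^sup>2"
      using norm_deflated[OF eig[of k]] \<rho>(3) by (simp add: power_mult_distrib)
    then have "norm ?D \<le> \<rho> * norm (A k - H k)"
      by (rule power2_le_imp_le) (simp add: \<rho>(1))
    moreover have "norm (A (Suc k) - H (Suc k)) \<le> norm ?D + norm (A (Suc k) - A k)"
      using norm_triangle_ineq[of ?D "A (Suc k) - A k"] by (simp add: update algebra_simps)
    ultimately show "norm (A (Suc k) - H (Suc k)) \<le> \<rho> * norm (A k - H k) + norm (A (Suc k) - A k)"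
      by linarith
  next
    have "(\<lambda>k. A (Suc k) - A k) \<longlonglongrightarrow> A' - A'"
      by (intro tendsto_diff lim LIMSEQ_Suc)
    then show "(\<lambda>k. norm (A (Suc k) - A k)) \<longlonglongrightarrow> 0"
      by (simp add: tendsto_norm_zero)
  qed (use \<rho> in simp_all)
  then show ?thesis
    by (rule tendsto_sandwich[rotated 2, OF tendsto_const])
       (simp_all add: second_le_norm[OF eig])
qed

context strongly_convex_problem
begin

text \<open>
  The centralized core of the argument. The iteration moves only if the residual \<open>R k\<close> of the Hessian
  approximation is at most \<open>r\<close>, and \<open>R\<close> is known to vanish in the limit provided that the iterates
  converge, which in particular is the case if they stop moving.
\<close>

theorem adaptive_newton_superlinear:
  fixes y :: "nat \<Rightarrow> real^'p" and H :: "nat \<Rightarrow> real^'p^'p" and R :: "nat \<Rightarrow> real"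
  assumes r: "0 < r" "3 * r < \<mu>" and \<phi>: "0 < \<phi>" "L * \<phi> \<le> (\<mu> - r) * (\<mu> - 3 * r)"
    and R_nonneg: "\<And>k. 0 \<le> R k"
    and approx: "\<And>k v. norm ((hessian F (y k) - H k) *v v) \<le> R k * norm v"
    and residual: "\<And>l. y \<longlonglongrightarrow> l \<Longrightarrow> R \<longlonglongrightarrow> 0"
    and stay: "\<And>k. r < R k \<Longrightarrow> y (Suc k) = y k"
    and move: "\<And>k. R k \<le> r \<Longrightarrow> y (Suc k) = y k -
      min 1 (\<phi> / norm (gradient F (y k))) *\<^sub>R (matrix_inv (H k) *v gradient F (y k))"
    and optimal: "is_arg_min F (\<lambda>_. True) xstar"
  shows "converges_superlinearly (\<lambda>k. norm (y k - xstar))"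
proof -
  define G where "G k = norm (gradient F (y k))" for k
  define d where "d k = matrix_inv (H k) *v gradient F (y k)" for k
  \<comment> \<open>If the gradient vanishes, \<open>\<alpha> k\<close> is 0 because of division by 0, and the iterate does not change.\<close>
  define \<alpha> where "\<alpha> k = min 1 (\<phi> / G k)" for k
  define \<eta> where "\<eta> = r / (\<mu> - r)"
  have \<mu>r: "0 < \<mu> - r" using r by simp
  have \<eta>_pos: "0 < \<eta>" using r \<mu>r by (simp add: \<eta>_def)
  have G_nonneg: "0 \<le> G k" for k by (simp add: G_def)
  have \<alpha>: "0 \<le> \<alpha> k" "\<alpha> k \<le> 1" for k
    using \<phi>(1) G_nonneg by (simp_all add: \<alpha>_def)
  have G_Suc: "G (Suc k) = norm (gradient F (y k - \<alpha> k *\<^sub>R d k))" if "R k \<le> r" for k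
    using move[OF that] by (simp add: G_def d_def \<alpha>_def)
  have d_le: "norm (d k) \<le> G k / (\<mu> - r)" if "R k \<le> r" for k
    unfolding d_def G_def
  proof (rule approximate_newton_step(1)[where \<alpha> = 1])
    show "norm ((hessian F (y k) - H k) *v v) \<le> r * norm v" for v
      using approx[of k v] that by (meson mult_right_mono norm_ge_zero order_trans)
  qed (use r \<mu>r in auto)
  have step: "G (Suc k) \<le>
      (1 - \<alpha> k) * G k + \<alpha> k * (R k * (G k / (\<mu> - r))) + L * (\<alpha> k * G k / (\<mu> - r))\<^sup>2"
    if "R k \<le> r" for k
  proof -
    have "G (Suc k) \<le> (1 - \<alpha> k) * G k + \<alpha> k * (R k * norm (d k)) + L * (\<alpha> k * norm (d k))\<^sup>2"
      unfolding G_Suc[OF that] unfolding G_def d_def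
      by (rule approximate_newton_step(2)[OF approx _ \<alpha>]) (use that r \<mu>r in simp)
    also have "\<dots> \<le> (1 - \<alpha> k) * G k + \<alpha> k * (R k * (G k / (\<mu> - r))) + L * (\<alpha> k * (G k / (\<mu> - r)))\<^sup>2"
      using d_le[OF that] \<alpha>[of k] R_nonneg[of k] L_pos
      by (intro add_mono order_refl mult_left_mono power_mono) simp_all
    finally show ?thesis by simp
  qed
  \<comment> \<open>Every move decreases the gradient norm by a fixed fraction of \<open>min (G k) \<phi>\<close>.\<close>
  have decrease: "G (Suc k) \<le> G k - \<eta> * min (G k) \<phi>" if "R k \<le> r" for k
  proof -
    define m where "m = min (G k) \<phi>"
    have m: "\<alpha> k * G k = m" "0 \<le> m" "m \<le> \<phi>"
      using \<phi>(1) G_nonneg[of k] by (auto simp: \<alpha>_def m_def min_def field_simps)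
    have "\<alpha> k * (R k * (G k / (\<mu> - r))) = m * (R k / (\<mu> - r))"
      unfolding m(1)[symmetric] by simp
    also have "\<dots> \<le> m * (r / (\<mu> - r))"
      using that \<mu>r m(2) by (intro mult_left_mono divide_right_mono) simp_all
    finally have *: "\<alpha> k * (R k * (G k / (\<mu> - r))) \<le> m * (r / (\<mu> - r))" .
    have "L * (m / (\<mu> - r))\<^sup>2 = m * (L * m / (\<mu> - r)\<^sup>2)"
      by (simp add: power2_eq_square)
    also have "\<dots> \<le> m * ((\<mu> - r) * (\<mu> - 3 * r) / (\<mu> - r)\<^sup>2)"
    proof (intro mult_left_mono divide_right_mono)
      have "L * m \<le> L * \<phi>" using L_pos m by simp
      then show "L * m \<le> (\<mu> - r) * (\<mu> - 3 * r)" using \<phi>(2) by simp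
    qed (use m in simp_all)
    also have "\<dots> = m * ((\<mu> - 3 * r) / (\<mu> - r))" using \<mu>r by (simp add: power2_eq_square)
    finally have **: "L * (m / (\<mu> - r))\<^sup>2 \<le> m * ((\<mu> - 3 * r) / (\<mu> - r))" .
    have "G (Suc k) \<le> (G k - m) + m * (r / (\<mu> - r)) + m * ((\<mu> - 3 * r) / (\<mu> - r))"
      using step[OF that] * ** unfolding m(1) by (simp add: left_diff_distrib m(1))
    also have "\<dots> = G k - m * (1 - r / (\<mu> - r) - (\<mu> - 3 * r) / (\<mu> - r))"
      by (simp add: algebra_simps)
    also have "1 - r / (\<mu> - r) - (\<mu> - 3 * r) / (\<mu> - r) = \<eta>"
    proof -
      have "1 - r / D - (D - 2 * r) / D = r / D" if "0 < D" for D :: real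
        using that by (simp add: field_simps)
      from this[OF \<mu>r] show ?thesis by (simp add: \<eta>_def)
    qed
    finally show ?thesis by (simp add: m_def mult.commute)
  qed
  have G_Suc_le: "G (Suc k) \<le> G k" for k
  proof (cases "R k \<le> r")
    case True
    have "0 \<le> \<eta> * min (G k) \<phi>" using \<eta>_pos G_nonneg \<phi> by simp
    then show ?thesis using decrease[OF True] by linarith
  next
    case False
    then show ?thesis using stay[of k] by (simp add: G_def)
  qed
  then have "decseq G" by (rule decseq_SucI)
  then obtain g where g: "G \<longlonglongrightarrow> g" "\<And>k. g \<le> G k"
    using decseq_convergent[of G 0] G_nonneg by blast
  \<comment> \<open>A positive limit would allow only finitely many moves. From then on the iterates are constant,
    so the residual vanishes in the limit and a further move takes place.\<close>
  have "g = 0"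
  proof (rule ccontr)
    assume "g \<noteq> 0"
    moreover have "0 \<le> g" using g(1) G_nonneg LIMSEQ_le_const by blast
    ultimately have "0 < \<eta> * min g \<phi>" using \<eta>_pos \<phi> by simp
    moreover have "(\<lambda>k. G k - G (Suc k)) \<longlonglongrightarrow> g - g"
      by (intro tendsto_diff g(1) LIMSEQ_Suc)
    ultimately have "\<forall>\<^sub>F k in sequentially. G k - G (Suc k) < \<eta> * min g \<phi>"
      by (intro order_tendstoD(2)) simp_all
    then obtain K where K: "\<And>k. K \<le> k \<Longrightarrow> G k - G (Suc k) < \<eta> * min g \<phi>"
      by (auto simp: eventually_sequentially)
    have no_move: "r < R k" if "K \<le> k" for k
    proof (rule ccontr)
      assume "\<not> r < R k"
      moreover have "\<eta> * min g \<phi> \<le> \<eta> * min (G k) \<phi>"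
        using \<eta>_pos g(2)[of k] by (intro mult_left_mono) auto
      ultimately show False using decrease[of k] K[OF that] by simp
    qed
    then have "y (K + m) = y K" for m
      by (induction m) (simp_all add: stay)
    then have "\<forall>k\<ge>K. y k = y K" by (auto simp: le_iff_add)
    then have "y \<longlonglongrightarrow> y K"
      by (intro tendsto_eventually) (unfold eventually_sequentially, blast)
    then have "\<forall>\<^sub>F k in sequentially. R k < r"
      by (rule order_tendstoD(2)[OF residual r(1)])
    then obtain k where "K \<le> k" "R k < r"
      unfolding eventually_sequentially by (metis nle_le)
    then show False using no_move[of k] by simp
  qed
  then have G: "G \<longlonglongrightarrow> 0" using g(1) by simp
  have error: "norm (y k - xstar) \<le> G k / \<mu>" for k
    using norm_error_le_norm_gradient[OF optimal] by (simp add: G_def)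
  have "(\<lambda>k. G k / \<mu>) \<longlonglongrightarrow> 0"
    using tendsto_divide[OF G tendsto_const[of \<mu>]] mu_pos by simp
  then have "(\<lambda>k. y k - xstar) \<longlonglongrightarrow> 0"
    by (rule Lim_null_comparison[rotated]) (simp add: error)
  then have "y \<longlonglongrightarrow> xstar" by (simp add: LIM_zero_iff)
  then have R: "R \<longlonglongrightarrow> 0" by (rule residual)
  \<comment> \<open>Eventually all steps are full steps, and the gradient norms have ratios tending to 0.\<close>
  have "\<forall>\<^sub>F k in sequentially. R k < r \<and> G k < \<phi>"
    using order_tendstoD(2)[OF R r(1)] order_tendstoD(2)[OF G \<phi>(1)] by (rule eventually_conj)
  then obtain K where K: "\<And>k. K \<le> k \<Longrightarrow> R k < r" "\<And>k. K \<le> k \<Longrightarrow> G k < \<phi>"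
    by (auto simp: eventually_sequentially)
  define q where "q k = R k / (\<mu> - r) + L * G k / (\<mu> - r)\<^sup>2" for k
  show ?thesis
  proof (rule converges_superlinearlyI[where a = "\<lambda>k. G k / \<mu>" and q = q])
    show "\<bar>norm (y k - xstar)\<bar> \<le> G k / \<mu>" for k using error by simp
    have "q \<longlonglongrightarrow> 0 / (\<mu> - r) + L * 0 / (\<mu> - r)\<^sup>2"
      unfolding q_def using \<mu>r by (intro tendsto_intros R G) simp_all
    then show "q \<longlonglongrightarrow> 0" by simp
    fix k assume "K \<le> k"
    show "G (Suc k) / \<mu> \<le> q k * (G k / \<mu>)"
    proof (cases "G k = 0")
      case True
      then show ?thesis using G_Suc_le[of k] G_nonneg[of "Suc k"] by simp
    next
      case False
      then have "\<alpha> k = 1" using K(2)[OF \<open>K \<le> k\<close>] G_nonneg[of k] by (simp add: \<alpha>_def)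
      then have "G (Suc k) \<le> q k * G k"
        using step[of k] K(1)[OF \<open>K \<le> k\<close>] by (simp add: q_def power2_eq_square algebra_simps)
      then show ?thesis using mu_pos by (simp add: divide_right_mono)
    qed
  qed
qed

end

section \<open>The distributed method\<close>

theorem theorem3:
  fixes n :: nat
    and G :: "nat pair_pre_digraph"
    and ident :: "nat \<Rightarrow> 'id"
    and f :: "nat \<Rightarrow> real^'p \<Rightarrow> real"
    and F :: "real^'p \<Rightarrow> real"
    and \<mu> L M c :: real
    and x :: "nat \<Rightarrow> nat \<Rightarrow> real^'p"
    and xstar :: "real^'p"
    and i :: nat
  defines "F \<equiv> (\<lambda>y. \<Sum>j=1..n. f j y)"
  assumes local_smooth: "\<And>j. j \<in> {1..n} \<Longrightarrow> twice_continuously_differentiable (f j)"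
    and smooth: "twice_continuously_differentiable F"
    and mu_pos: "\<mu> > 0"
    and strongly_convex: "\<And>y. loewner_le (\<mu> *\<^sub>R mat 1) (hessian F y)"
    and L_pos: "L > 0"
    and lipschitz: "\<And>y z. spectral_norm (hessian F y - hessian F z) \<le> L * norm (y - z)"
    and upper: "\<And>y. loewner_le (hessian F y) (M *\<^sub>R mat 1)"
    and network: "pair_wf_digraph G" "pverts G = {1..n}" "strongly_connected (with_proj G)"
    and identifiers: "inj_on ident {1..n}"
    and c_pos: "c > 0"
    and run: "danla_run G ident f \<mu> L M c x"
    and optimal: "is_arg_min F (\<lambda>_. True) xstar"
    and node: "i \<in> {1..n}"
  shows "converges_superlinearly (\<lambda>k. norm (x k i - xstar))"
proof -
  interpret strongly_convex_problem F \<mu> L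
    by unfold_locales (rule smooth mu_pos strongly_convex L_pos lipschitz)+
  let ?V = "{1..n}" and ?r = "r_under \<mu> M c" and ?\<phi> = "step_const \<mu> L M c"

  have "\<mu> \<le> M"
  proof -
    define v :: "real^'p" where "v = axis undefined 1"
    have "norm v = 1" by (simp add: v_def)
    have "0 \<le> v \<bullet> ((M *\<^sub>R mat 1 - hessian F xstar) *v v)"
      using upper by (simp add: loewner_le_def)
    then have "v \<bullet> (hessian F xstar *v v) \<le> M * (norm v)\<^sup>2"
      by (simp add: matrix_vector_mult_diff_rdistrib scaleR_matrix_vector_assoc[symmetric]
          inner_diff_right power2_norm_eq_inner)
    then show ?thesis
      using hessian_coercive[of v xstar] \<open>norm v = 1\<close> by simp
  qed
  note constants = step_constants[OF mu_pos this L_pos c_pos]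

  obtain N x0 H Hhat h s r g out where
    net: "dsf_network G N" and
    init: "\<forall>u\<in>?V. x 0 u = x0 \<and> H 0 u = 0 \<and> Hhat 0 u = 0" and
    iteration: "\<forall>k. (\<forall>u\<in>?V.
             (\<exists>lam w. eigen_by_magnitude (hessian (f u) (x k u) - H k u) lam w \<and>
                h k u = sqrt \<bar>lam 1\<bar> *\<^sub>R w 1 \<and> s k u = sgn (lam 1) \<and> r k u = \<bar>lam 2\<bar>) \<and>
             H (Suc k) u = H k u + s k u *\<^sub>R outer_square (h k u) \<and>
             g k u = gradient (f u) (x k u)) \<and>
          dsf G N (\<lambda>u. (ident u, r k u, s k u, g k u, h k u)) (out k) \<and>
          (\<forall>u\<in>?V.
             let ghat = (\<Sum>(d, ru, su, gu, hu)\<in>out k u. gu);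
                 rhat = (\<Sum>(d, ru, su, gu, hu)\<in>out k u. ru);
                 \<alpha> = (if rhat \<le> ?r then min 1 (?\<phi> / norm ghat) else 0)
             in Hhat (Suc k) u =
                  Hhat k u + (\<Sum>(d, ru, su, gu, hu)\<in>out k u. su *\<^sub>R outer_square hu) \<and>
                x (Suc k) u =
                  (if \<alpha> = 0 then x k u
                   else x k u - \<alpha> *\<^sub>R (matrix_inv (Hhat (Suc k) u) *v ghat)))"
    using run unfolding danla_run_def network(2) by (elim exE conjE) blast

  define S where "S k u = (ident u, r k u, s k u, g k u, h k u)" for k u
  have inj_S: "inj_on (S k) ?V" for k
  proof (rule inj_onI)
    fix u v assume "u \<in> ?V" "v \<in> ?V" "S k u = S k v"
    then show "u = v" using inj_onD[OF identifiers, of u v] by (simp add: S_def)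
  qed
  have out: "out k u = S k ` ?V" if "u \<in> ?V" for k u
  proof -
    have "dsf G N (S k) (out k)"
      using iteration unfolding S_def[abs_def] by blast
    then show ?thesis
      using dsf_output[of G N "S k" "out k" u] network net inj_S[of k] that by simp
  qed
  have sum_out: "sum e (out k u) = (\<Sum>v\<in>?V. e (S k v))" if "u \<in> ?V"
    for e :: "_ \<Rightarrow> 'b::comm_monoid_add" and k u
    unfolding out[OF that] sum.reindex[OF inj_S] by (simp add: o_def)

  have "\<forall>k u. \<exists>lam w. u \<in> ?V \<longrightarrow> eigen_by_magnitude (hessian (f u) (x k u) - H k u) lam w \<and>
     h k u = sqrt \<bar>lam 1\<bar> *\<^sub>R w 1 \<and> s k u = sgn (lam 1) \<and> r k u = \<bar>lam 2\<bar>"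
    using iteration by blast
  then obtain lam w where eig0: "\<And>k u. u \<in> ?V \<Longrightarrow>
     eigen_by_magnitude (hessian (f u) (x k u) - H k u) (lam k u) (w k u) \<and>
     h k u = sqrt \<bar>lam k u 1\<bar> *\<^sub>R w k u 1 \<and> s k u = sgn (lam k u 1) \<and> r k u = \<bar>lam k u 2\<bar>"
    by metis
  have update: "H (Suc k) u = H k u + lam k u 1 *\<^sub>R outer_square (w k u 1)" if "u \<in> ?V" for k u
    using iteration that eig0[OF that, of k] by (simp add: signed_outer_square)

  \<comment> \<open>All nodes have the same iterate and the same aggregated matrix.\<close>
  define y where "y k = x k i" for k
  have sync: "\<forall>u\<in>?V. x k u = y k \<and> Hhat k u = (\<Sum>v\<in>?V. H k v)" for k
  proof (induction k)
    case 0
    then show ?case using init node by (simp add: y_def)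
  next
    case (Suc k)
    have H_sum: "Hhat (Suc k) u = (\<Sum>v\<in>?V. H (Suc k) v)" if "u \<in> ?V" for u
    proof -
      have "Hhat (Suc k) u = (\<Sum>v\<in>?V. H k v) + (\<Sum>v\<in>?V. s k v *\<^sub>R outer_square (h k v))"
        using iteration that Suc by (auto simp: Let_def sum_out S_def)
      also have "\<dots> = (\<Sum>v\<in>?V. H (Suc k) v)"
        using iteration by (simp add: sum.distrib)
      finally show ?thesis .
    qed
    have "x (Suc k) u = x (Suc k) i" if "u \<in> ?V" for u
      using iteration that node Suc by (simp add: Let_def out H_sum)
    with H_sum show ?case by (simp add: y_def)
  qed
  define R where "R k = (\<Sum>u\<in>?V. r k u)" for k
  define Hs where "Hs k = (\<Sum>u\<in>?V. H (Suc k) u)" for k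
  have eig: "eigen_by_magnitude (hessian (f u) (y k) - H k u) (lam k u) (w k u)"
    and r_eq: "r k u = \<bar>lam k u 2\<bar>" if "u \<in> ?V" for k u
    using eig0[OF that, of k] sync that by auto
  have gradient_F: "gradient F (y k) = (\<Sum>u\<in>?V. g k u)" for k
    unfolding F_def using gradient_sum[of ?V f "y k"] local_smooth iteration sync by simp
  have step: "y (Suc k) = (let \<alpha> = (if R k \<le> ?r then min 1 (?\<phi> / norm (gradient F (y k))) else 0)
      in if \<alpha> = 0 then y k else y k - \<alpha> *\<^sub>R (matrix_inv (Hs k) *v gradient F (y k)))" for k
  proof -
    have "Hhat (Suc k) i = Hs k" using sync[of "Suc k"] node by (simp add: Hs_def)
    moreover have "(\<Sum>(d, ru, su, gu, hu)\<in>out k i. gu) = gradient F (y k)"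
      "(\<Sum>(d, ru, su, gu, hu)\<in>out k i. ru) = R k"
      by (simp_all add: sum_out[OF node] S_def gradient_F R_def)
    ultimately show ?thesis using iteration node by (simp add: Let_def y_def)
  qed

  have "converges_superlinearly (\<lambda>k. norm (y k - xstar))"
  proof (rule adaptive_newton_superlinear[OF constants _ _ _ _ _ optimal, where R = R and H = Hs])
    show "0 \<le> R k" for k unfolding R_def by (rule sum_nonneg) (simp add: r_eq)
    show "norm ((hessian F (y k) - Hs k) *v v) \<le> R k * norm v" for k v
    proof -
      have "hessian F (y k) - Hs k = (\<Sum>u\<in>?V. hessian (f u) (y k) - H (Suc k) u)"
        unfolding F_def Hs_def using hessian_sum[of ?V f] local_smooth smooth
        by (simp add: F_def sum_subtractf)
      then have "norm ((hessian F (y k) - Hs k) *v v)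
          \<le> (\<Sum>u\<in>?V. norm ((hessian (f u) (y k) - H (Suc k) u) *v v))"
        by (simp add: sum_matrix_vector_mult norm_sum)
      also have "\<dots> \<le> (\<Sum>u\<in>?V. r k u * norm v)"
        using norm_deflated_mult_le[OF eig] by (intro sum_mono) (simp add: update r_eq diff_diff_add)
      also have "\<dots> = R k * norm v" by (simp add: R_def sum_distrib_right)
      finally show ?thesis .
    qed
    show "R \<longlonglongrightarrow> 0" if "y \<longlonglongrightarrow> l" for l
    proof -
      have "(\<lambda>k. r k u) \<longlonglongrightarrow> 0" if "u \<in> ?V" for u
        unfolding r_eq[OF that]
      proof (rule rank_one_tracking[where A = "\<lambda>k. hessian (f u) (y k)" and H = "\<lambda>k. H k u"
            and w = "\<lambda>k. w k u"])
        show "eigen_by_magnitude (hessian (f u) (y k) - H k u) (lam k u) (w k u)"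
          "H (Suc k) u = H k u + lam k u 1 *\<^sub>R outer_square (w k u 1)" for k
          using eig update that by blast+
        have "continuous_on UNIV (hessian (f u))"
          using local_smooth[OF that] by (simp add: twice_continuously_differentiable_def)
        then show "(\<lambda>k. hessian (f u) (y k)) \<longlonglongrightarrow> hessian (f u) l"
          using \<open>y \<longlonglongrightarrow> l\<close> by (rule continuous_on_tendsto_compose) simp_all
      qed
      then have "(\<lambda>k. \<Sum>u\<in>?V. r k u) \<longlonglongrightarrow> (\<Sum>u\<in>?V. 0)" by (rule tendsto_sum)
      then show ?thesis by (simp add: R_def[abs_def])
    qed
    show "y (Suc k) = y k" if "?r < R k" for k
      using step[of k] that by simp
    show "y (Suc k) = y k - min 1 (?\<phi> / norm (gradient F (y k))) *\<^sub>R (matrix_inv (Hs k) *v gradient F (y k))"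
      if "R k \<le> ?r" for k
      using step[of k] that by (simp add: Let_def)
  qed
  then show ?thesis by (simp add: y_def)
qed

end
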